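(* Let $a,k,x$ be non-negative integers and let $j$ be an integer with $\max(1,k)\le j\le a+k+1$. Let $R_{a,k,j,x}$ be the region of the triangular lattice defined in the context. Then the number of lozenge tilings of $R_{a,k,j,x}$ is \begin{multline*} M(R_{a,k,j,x})=\left[\prod_{n=1}^a\left(\frac{x+k+n}{k+n}\right)^{f_{a}(n)}\right]\left[\prod_{n=1}^{a-1}\left(\frac{2x+2k+2n+1}{2k+2n+1}\right)^{f_{a-1}(n)}\right]\\ \times\left[\prod_{n=1}^{j-k-1}\left(\frac{k+n}{x+k+n}\right)^{f_{j-k-1}(n)}\right]\left[\prod_{n=1}^{j-k-2}\left(\frac{2k+2n+1}{2x+2k+2n+1}\right)^{f_{j-k-2}(n)}\right]\\ \times\left[\prod_{n=1}^{j-1}\frac{x+n}{2x+n}\right]\left[\prod_{1\leq n\leq m\leq j-1}\frac{2x+n+m-1}{n+m-1}\right]\\ \times\prod_{n=1}^{a-j+k+1}\left[\prod_{m=1}^{j-k}\frac{k+n+m-1}{n+m-1}\prod_{m=j-k+1}^{j-k-1+n}\frac{2k+n+m-1}{n+m-1}\right], \end{multline*} where $f_a(i)=\frac{a+1}{2}-\left|\frac{a+1}{2}-i\right|$ and empty products (upper limit smaller than lower limit) equal $1$.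
   Context: Work in the triangular lattice: the tiling of the plane by unit equilateral triangles whose edges lie on horizontal lines and on lines at $60^\circ$ and $120^\circ$ to the horizontal. Each unit triangle points either up or down. A region is a finite union of unit triangles; a lozenge is the union of two unit triangles sharing an edge; a lozenge tiling of a region is a covering of it by non-overlapping lozenges. $M(R)$ denotes the number of lozenge tilings of $R$ (more generally, for weighted lozenges, the sum over tilings of the product of the weights of the lozenges used). The region $R_{a,k,j,x}$: its boundary, traced clockwise from its northwest corner, consists of a horizontal north edge of length $x$ going east, then a northeast edge of length $a+2k$ going down and to the right (direction $-60^\circ$), then a southeast edge of length $a$ going down and to the left (direction $-120^\circ$), then a horizontal south edge of length $x+k$ going west, and finally a zigzag line of $2a+2k$ unit segments, going upward from the west end of the south edge to the west end of the north edge, whose segments alternate between northwest and northeast (starting with northwest), forming $a+k$ westward "bumps". Along the northeast edge there are $a+2k$ upward-pointing unit triangles of the region having an edge on that side; numbering them $1,2,\dots,a+2k$ from the north end, one removes the $k$ consecutive ones numbered $j,j+1,\dots,j+k-1$ (so a gap of $j-1$ such triangles is left at the top). All lozenges have weight $1$. *)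

theory Defs
  imports Complex_Main "HOL-Library.Disjoint_Sets"
begin

text \<open>
  The vertices of the triangular lattice are written in the basis consisting of the unit vector
  pointing east and the unit vector at 60 degrees to it: the pair \<open>(p, q)\<close> stands for the point
  \<open>p * (1, 0) + q * (1/2, sqrt 3 / 2)\<close> of the plane. The unit steps are therefore
  east \<open>(1, 0)\<close>, northeast \<open>(0, 1)\<close>, northwest \<open>(-1, 1)\<close>, and west \<open>(-1, 0)\<close>,
  southwest \<open>(0, -1)\<close>, southeast \<open>(1, -1)\<close>.
  A unit triangle is given by the set of its three vertices.
\<close>

type_synonym lattice_point = "int \<times> int"
type_synonym unit_triangle = "lattice_point set"

definition up_triangle :: "int \<Rightarrow> int \<Rightarrow> unit_triangle" where
  "up_triangle p q = {(p, q), (p + 1, q), (p, q + 1)}"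

definition down_triangle :: "int \<Rightarrow> int \<Rightarrow> unit_triangle" where
  "down_triangle p q = {(p, q), (p + 1, q), (p + 1, q - 1)}"

definition unit_triangles :: "unit_triangle set" where
  "unit_triangles = {t. \<exists>p q. t = up_triangle p q \<or> t = down_triangle p q}"

text \<open>
  A region is the set of the unit triangles it consists of, and likewise a lozenge is the pair of its
  two unit triangles. Two unit triangles share an edge iff they have exactly two common vertices.
  Lozenges do not overlap iff they have no unit triangle in common, so that a tiling
  is a partition of the set of unit triangles of the region into lozenges.
\<close>

definition lozenges :: "unit_triangle set set" where
  "lozenges = {{s, t} | s t. s \<in> unit_triangles \<and> t \<in> unit_triangles \<and> card (s \<inter> t) = 2}"

definition lozenge_tilings :: "unit_triangle set \<Rightarrow> unit_triangle set set set" where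
  "lozenge_tilings R = {T. T \<subseteq> lozenges \<and> partition_on R T}"

definition M :: "unit_triangle set \<Rightarrow> nat" where
  "M R = card (lozenge_tilings R)"

text \<open>
  The boundary is described by its west and east parts, whose vertices at distance \<open>d\<close> rows below the
  north side are \<open>(west_boundary d, -d)\<close> and \<open>(east_boundary a k x d, -d)\<close>; the northwest corner is
  \<open>(0, 0)\<close>. The lemmas below exhibit the two parts as the lattice paths (read downward) that
  define the region: the zigzag on the west side, and \<open>a + 2k\<close> southeast steps followed by
  \<open>a\<close> southwest steps on the east side, with sides of length \<open>x\<close> and \<open>x + k\<close>
  in the north and in the south.
\<close>

definition west_boundary :: "int \<Rightarrow> int" where
  "west_boundary d = d div 2"

definition east_boundary :: "nat \<Rightarrow> nat \<Rightarrow> nat \<Rightarrow> int \<Rightarrow> int" where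
  "east_boundary a k x d = int x + min d (int (a + 2 * k))"

lemma north_side: "west_boundary 0 = 0" "east_boundary a k x 0 = west_boundary 0 + int x"
  by (simp_all add: west_boundary_def east_boundary_def)

lemma south_side:
  "east_boundary a k x (int (2 * a + 2 * k)) = west_boundary (int (2 * a + 2 * k)) + int (x + k)"
  by (simp add: west_boundary_def east_boundary_def)

lemma west_boundary_step:
  "(west_boundary (d + 1), - (d + 1)) =
     (if even d then (west_boundary d + 0, - d + (- 1)) else (west_boundary d + 1, - d + (- 1)))"
  unfolding west_boundary_def by (auto elim!: evenE oddE)

lemma east_boundary_step:
  "(east_boundary a k x (d + 1), - (d + 1)) =
     (if d < int (a + 2 * k) then (east_boundary a k x d + 1, - d + (- 1))
      else (east_boundary a k x d + 0, - d + (- 1)))"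
  by (auto simp: east_boundary_def)

definition enclosed_points :: "nat \<Rightarrow> nat \<Rightarrow> nat \<Rightarrow> lattice_point set" where
  "enclosed_points a k x =
     {(p, - d) | p d. 0 \<le> d \<and> d \<le> int (2 * a + 2 * k) \<and>
                      west_boundary d \<le> p \<and> p \<le> east_boundary a k x d}"

text \<open>
  Between two consecutive horizontal lattice lines the part of the plane enclosed by the boundary is a
  trapezoid, hence convex, so a unit triangle lies inside the boundary iff its three vertices do.
\<close>

definition enclosed_triangles :: "nat \<Rightarrow> nat \<Rightarrow> nat \<Rightarrow> unit_triangle set" where
  "enclosed_triangles a k x = {t \<in> unit_triangles. t \<subseteq> enclosed_points a k x}"

text \<open>
  The \<open>i\<close>-th upward-pointing unit triangle along the northeast side, counted from the north end
  (\<open>1 \<le> i \<le> a + 2k\<close>).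
\<close>

definition ne_triangle :: "nat \<Rightarrow> nat \<Rightarrow> unit_triangle" where
  "ne_triangle x i = up_triangle (int x + int i - 1) (- int i)"

lemma ne_triangle_edge:
  assumes "1 \<le> i" "i \<le> a + 2 * k"
  shows "ne_triangle x i =
    {(east_boundary a k x (int i - 1), - (int i - 1)), (east_boundary a k x (int i), - int i),
     (east_boundary a k x (int i) - 1, - int i)}"
  using assms by (auto simp: ne_triangle_def up_triangle_def east_boundary_def)

definition R :: "nat \<Rightarrow> nat \<Rightarrow> nat \<Rightarrow> nat \<Rightarrow> unit_triangle set" where
  "R a k j x = enclosed_triangles a k x - ne_triangle x ` {j..<j + k}"

definition f :: "nat \<Rightarrow> nat \<Rightarrow> real" where
  "f a i = (real a + 1) / 2 - \<bar>(real a + 1) / 2 - real i\<bar>"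

end

theory Submission
  imports Defs "Jordan_Normal_Form.Determinant"
begin

text \<open>
  Cut the region into strips along the lattice lines \<open>p + q = c\<close>. The lozenges that lie
  inside a strip form paths that start at the \<open>a + k\<close> bumps of the zigzag side and end on the northeast side, in
  the rows of the triangles that were not removed. Hence the number of tilings is
  \<open>det (binomial (x + m) (2 * m - i))\<close> with \<open>1 \<le> m \<le> a + k\<close> and \<open>i\<close> in
  \<open>{1..j-1} \<union> {j+k..a+2k}\<close>: removing the triangles of a strip one after the other corresponds to
  expanding the columns of the determinant by Pascal's rule.

  Replacing \<open>x\<close> by \<open>x + 1\<close> multiplies the determinant by an explicit factor, because up to a scaling of the
  columns it is a multiplication by a lower bidiagonal matrix. The determinant for \<open>x = 0\<close>
  follows by induction from a three-term Pluecker relation, in which the columns \<open>j\<close>, \<open>j + k\<close>,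
  \<open>a + 2 * k\<close> and a unit vector are exchanged.
\<close>

section \<open>Determinants as functions of the list of columns\<close>

text \<open>Path families are never formed. Regions in mid-removal are counted, and the determinant
  does the bookkeeping: a blocked move gives two equal columns or a zero column, a bump that cannot
  be served gives a zero row. This takes the place of a sign-reversing involution.

  The dependence on \<open>x\<close> splits off because in the entry
  \<open>binomial (x + m) (2 * m - i)\<close> twice the upper minus the lower argument is
  \<open>2 * x + i\<close>, which is free of the row.

  At \<open>x = 0\<close> only the last product of the formula differs from 1, so it is the value to
  be proved there. The unit vector lets the relation link determinants of two consecutive sizes. The
  relation also changes \<open>j\<close> and \<open>k\<close>, so the induction runs over the number
  of columns behind the gap, for all \<open>j\<close> and \<open>k\<close> at once.\<close>

definition col_mat :: "(nat \<Rightarrow> real) list \<Rightarrow> real mat" where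
  "col_mat L = mat (length L) (length L) (\<lambda>(r, s). (L ! s) r)"

text \<open>Columns are functions on all of \<open>nat\<close> and the length of the list fixes the
  size, so one column can stand in determinants of different sizes, and appending a column also adds
  a row.\<close>

definition col_det :: "(nat \<Rightarrow> real) list \<Rightarrow> real" where
  "col_det L = det (col_mat L)"

definition unit_col :: "nat \<Rightarrow> nat \<Rightarrow> real" where
  "unit_col m r = of_bool (r = m)"

lemma col_mat_carrier [simp]: "col_mat L \<in> carrier_mat (length L) (length L)"
  by (simp add: col_mat_def)

text \<open>Laplace expansion along the column of \<open>u\<close>: its cofactors do not see that
  column, so one \<open>c\<close> serves all \<open>u\<close>.\<close>

lemma col_det_linear:
  "\<exists>c. \<forall>u. col_det (A @ u # B) = (\<Sum>r<length A + length B + 1. u r * c r)"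
proof -
  define n where "n = length A + length B + 1"
  let ?c = "\<lambda>u r. cofactor (col_mat (A @ u # B)) r (length A)"
  have c: "?c u r = ?c (\<lambda>_. 0) r" for u r
  proof -
    have "mat_delete (col_mat (A @ u # B)) r (length A)
        = mat_delete (col_mat (A @ (\<lambda>_. 0) # B)) r (length A)"
      by (rule eq_matI) (auto simp: mat_delete_def col_mat_def nth_append)
    then show ?thesis by (simp add: cofactor_def)
  qed
  have "col_det (A @ u # B) = (\<Sum>r<n. u r * ?c (\<lambda>_. 0) r)" for u
  proof -
    have "col_det (A @ u # B) = (\<Sum>r<n. col_mat (A @ u # B) $$ (r, length A) * ?c u r)"
      unfolding col_det_def
      by (rule laplace_expansion_column) (auto simp: n_def col_mat_def)
    also have "\<dots> = (\<Sum>r<n. u r * ?c (\<lambda>_. 0) r)"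
      by (intro sum.cong refl) (subst c, auto simp: col_mat_def n_def)
    finally show ?thesis .
  qed
  then show ?thesis unfolding n_def by (intro exI allI)
qed

lemma col_det_add:
  "col_det (A @ (\<lambda>r. u r + v r) # B) = col_det (A @ u # B) + col_det (A @ v # B)"
proof -
  obtain c where "\<And>u. col_det (A @ u # B) = (\<Sum>r<length A + length B + 1. u r * c r)"
    using col_det_linear by blast
  then show ?thesis by (simp add: distrib_right sum.distrib)
qed

lemma col_det_zero_col:
  assumes "\<And>r. r < length A + length B + 1 \<Longrightarrow> u r = 0"
  shows "col_det (A @ u # B) = 0"
proof -
  obtain c where "\<And>u. col_det (A @ u # B) = (\<Sum>r<length A + length B + 1. u r * c r)"
    using col_det_linear by blast
  then show ?thesis using assms by simp
qed

lemma col_det_nth_eq: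
  assumes "i < j" "j < length L" "L ! i = L ! j"
  shows "col_det L = 0"
  unfolding col_det_def
  by (rule det_identical_columns[of _ "length L" i j])
     (use assms in \<open>auto simp: col_mat_def intro!: eq_vecI\<close>)

lemma col_det_not_distinct:
  assumes "\<not> distinct L"
  shows "col_det L = 0"
  using assms col_det_nth_eq[of _ _ L] unfolding distinct_conv_nth
  by (metis nat_neq_iff)

lemma col_det_zero_row:
  assumes "r < length L" "\<And>s. s < length L \<Longrightarrow> (L ! s) r = 0"
  shows "col_det L = 0"
proof -
  have "row (col_mat L) r = 0\<^sub>v (length L)"
    using assms by (auto simp: col_mat_def intro!: eq_vecI)
  moreover have "det (col_mat L) = (\<Sum>s<length L. col_mat L $$ (r, s) * cofactor (col_mat L) r s)"
    by (rule laplace_expansion_row) (use assms in auto)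
  ultimately show ?thesis
    using assms by (simp add: col_det_def col_mat_def)
qed

lemma col_det_swap:
  "col_det (A @ u # B @ v # C) = - col_det (A @ v # B @ u # C)"
proof -
  let ?w = "\<lambda>r. u r + v r"
  have lin1: "col_det (A @ (\<lambda>r. u r + v r) # B @ w # C)
      = col_det (A @ u # B @ w # C) + col_det (A @ v # B @ w # C)" for w
    by (rule col_det_add)
  have lin2: "col_det (A @ w # B @ (\<lambda>r. u r + v r) # C)
      = col_det (A @ w # B @ u # C) + col_det (A @ w # B @ v # C)" for w
    using col_det_add[of "A @ w # B" u v C] by simp
  have eq: "col_det (A @ w # B @ w # C) = 0" for w
    by (rule col_det_not_distinct) simp
  show ?thesis
    using eq[of ?w] eq[of u] eq[of v] unfolding lin1 lin2 by simp
qed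

lemma col_det_rotate:
  "col_det (A @ u # B @ C) = (-1) ^ length B * col_det (A @ B @ u # C)"
proof (induction B arbitrary: A)
  case (Cons b B)
  have "col_det (A @ u # (b # B) @ C) = - col_det (A @ [b] @ u # B @ C)"
    using col_det_swap[of A u "[]" b "B @ C"] by simp
  also have "\<dots> = - ((-1) ^ length B * col_det ((A @ [b]) @ B @ u # C))"
    using Cons.IH[of "A @ [b]"] by simp
  finally show ?case by simp
qed simp

lemma col_det_append_unit_col:
  "col_det (L @ [unit_col (length L)]) = col_det L"
proof -
  let ?n = "length L" and ?L = "L @ [unit_col (length L)]"
  have "col_det ?L = (\<Sum>r<Suc ?n. col_mat ?L $$ (r, ?n) * cofactor (col_mat ?L) r ?n)"
    unfolding col_det_def by (rule laplace_expansion_column) (auto simp: col_mat_def)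
  also have "\<dots> = cofactor (col_mat ?L) ?n ?n"
    by (simp add: col_mat_def unit_col_def)
  also have "mat_delete (col_mat ?L) ?n ?n = col_mat L"
    by (rule eq_matI) (auto simp: mat_delete_def col_mat_def nth_append)
  then have "cofactor (col_mat ?L) ?n ?n = col_det L"
    by (simp add: cofactor_def col_det_def flip: mult_2)
  finally show ?thesis .
qed

lemma col_det_Nil [simp]: "col_det [] = 1"
  by (simp add: col_det_def col_mat_def)

lemma col_det_unit_cols: "col_det (map unit_col [0..<n]) = 1"
  by (induction n) (use col_det_append_unit_col[of "map unit_col [0..<_]"] in auto)

lemma col_det_upper_triangular:
  assumes "\<And>r s. s < r \<Longrightarrow> r < length L \<Longrightarrow> (L ! s) r = 0"
  shows "col_det L = (\<Prod>r<length L. (L ! r) r)"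
proof -
  have "det (col_mat L) = prod_list (diag_mat (col_mat L))"
    by (rule det_upper_triangular[of _ "length L"]) (use assms in \<open>auto simp: col_mat_def upper_triangular_def\<close>)
  also have "diag_mat (col_mat L) = map (\<lambda>r. (L ! r) r) [0..<length L]"
    by (auto simp: diag_mat_def col_mat_def)
  finally show ?thesis
    by (simp add: col_det_def prod.list_conv_set_nth flip: lessThan_atLeast0)
qed

text \<open>Pigeonhole: the \<open>p + 1\<close> rows up to \<open>p\<close> have only
  \<open>p\<close> columns outside the zero block, so every permutation in the Leibniz formula meets
  the block.\<close>

lemma col_det_zero_block:
  assumes "p < length L" "\<And>r s. r \<le> p \<Longrightarrow> p \<le> s \<Longrightarrow> s < length L \<Longrightarrow> (L ! s) r = 0"
  shows "col_det L = 0"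
proof -
  let ?n = "length L"
  have "(\<Prod>i = 0..<?n. col_mat L $$ (i, q i)) = 0" if q: "q permutes {0..<?n}" for q
  proof -
    have "\<exists>i\<le>p. p \<le> q i"
    proof (rule ccontr)
      assume "\<not> ?thesis"
      then have "q i < p" if "i \<le> p" for i using that not_le by blast
      then have "q ` {..p} \<subseteq> {..<p}" by auto
      then have "card (q ` {..p}) \<le> card {..<p}" by (intro card_mono) auto
      moreover have "card (q ` {..p}) = card {..p}"
        using permutes_inj[OF q] by (intro card_image) (auto simp: inj_on_def)
      ultimately show False by simp
    qed
    then obtain i where i: "i \<le> p" "p \<le> q i" by blast
    then have "q i < ?n" using permutes_in_image[OF q, of i] assms(1) by simp
    then have "col_mat L $$ (i, q i) = 0" using i assms by (simp add: col_mat_def)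
    then show ?thesis using i assms(1) by (intro prod_zero) auto
  qed
  then show ?thesis
    unfolding col_det_def det_def'[OF col_mat_carrier]
    by (intro sum.neutral ballI) (metis mem_Collect_eq mult_zero_right)
qed

text \<open>
  The left-hand side is linear in \<open>a\<close> and vanishes on the columns of \<open>A\<close> and \<open>B\<close> and on
  \<open>b\<close>, \<open>c\<close>, \<open>d\<close>. These span the whole space unless \<open>\<psi> b c\<close>, \<open>\<psi> b d\<close> and \<open>\<psi> c d\<close> are all zero.
\<close>

lemma col_det_pluecker:
  fixes A B :: "(nat \<Rightarrow> real) list"
  defines "\<psi> \<equiv> \<lambda>u v. col_det (A @ u # B @ [v])"
  shows "\<psi> a b * \<psi> c d - \<psi> a c * \<psi> b d + \<psi> a d * \<psi> b c = 0"
proof -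
  define n where "n = length A + length B + 2"
  have "\<exists>c. \<forall>u. \<psi> u v = (\<Sum>r<n. u r * c r)" for v
    using col_det_linear[of A "B @ [v]"] by (simp add: \<psi>_def n_def)
  then obtain w where w: "\<And>u v. \<psi> u v = (\<Sum>r<n. u r * w v r)" by metis
  define X where "X = (\<lambda>u. \<psi> u b * \<psi> c d - \<psi> u c * \<psi> b d + \<psi> u d * \<psi> b c)"
  define g where "g = (\<lambda>r. w b r * \<psi> c d - w c r * \<psi> b d + w d r * \<psi> b c)"
  have X: "X u = (\<Sum>r<n. u r * g r)" for u
    unfolding X_def g_def w[of u]
    by (simp add: distrib_left right_diff_distrib sum.distrib sum_subtractf sum_distrib_right mult.assoc)
  have anti: "\<psi> u v = - \<psi> v u" for u v
    unfolding \<psi>_def using col_det_swap[of A u B v "[]"] by simp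
  have self: "\<psi> u u = 0" for u
    using anti[of u u] by simp
  have X0: "X u = 0" if "u \<in> set A \<union> set B \<union> {b, c, d}" for u
  proof -
    have "\<psi> u v = 0" if "u \<in> set A \<union> set B" for v
      unfolding \<psi>_def by (rule col_det_not_distinct) (use that in auto)
    then show ?thesis
      using that anti[of c b] anti[of d b] anti[of d c] by (auto simp: X_def self)
  qed
  have "X a = 0" if uv: "u \<in> {b, c, d}" "v \<in> {b, c, d}" "\<psi> u v \<noteq> 0" for u v
  proof -
    let ?L = "A @ u # B @ [v]"
    have len: "length ?L = n" by (simp add: n_def)
    have car: "transpose_mat (col_mat ?L) \<in> carrier_mat n n"
      using col_mat_carrier[of ?L] len by simp
    \<comment> \<open>Spanning in dual form: the coefficient vector \<open>g\<close> of
      \<open>X\<close> is orthogonal to every column of an invertible matrix, hence zero.\<close>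
    have "transpose_mat (col_mat ?L) *\<^sub>v vec n g = 0\<^sub>v n"
    proof (rule eq_vecI)
      fix s assume "s < dim_vec (0\<^sub>v n)"
      then have s: "s < n" by simp
      have "(transpose_mat (col_mat ?L) *\<^sub>v vec n g) $ s = (\<Sum>r<n. (?L ! s) r * g r)"
        using s len by (simp add: col_mat_def scalar_prod_def lessThan_atLeast0)
      also have "\<dots> = X (?L ! s)" by (simp add: X)
      also have "?L ! s \<in> set ?L" using s len by (metis nth_mem)
      then have "X (?L ! s) = 0" using uv by (intro X0) auto
      finally show "(transpose_mat (col_mat ?L) *\<^sub>v vec n g) $ s = 0\<^sub>v n $ s" using s by simp
    qed (use len in \<open>simp add: col_mat_def\<close>)
    moreover have "det (transpose_mat (col_mat ?L)) \<noteq> 0"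
      using uv(3) det_transpose[OF col_mat_carrier[of ?L]] by (simp add: \<psi>_def col_det_def)
    ultimately have "vec n g = 0\<^sub>v n"
      using det_0_iff_vec_prod_zero[OF car] by (metis vec_carrier)
    then have "g r = 0" if "r < n" for r
      using that by (metis index_vec index_zero_vec(1))
    then show ?thesis by (simp add: X)
  qed
  then have "X a = 0 \<or> (\<psi> b c = 0 \<and> \<psi> b d = 0 \<and> \<psi> c d = 0)" by blast
  then show ?thesis by (auto simp: X_def)
qed

text \<open>Hypothesis \<open>eq\<close> is the matrix identity
  \<open>col_mat L' * ?W = ?T * col_mat L\<close> with a diagonal and a lower triangular factor.
  Keeping the weights on the left avoids dividing by them.\<close>

lemma col_det_scale_transform:
  assumes len: "length L = length L'"
    and low: "\<And>r t. r < t \<Longrightarrow> l r t = 0"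
    and eq: "\<And>r s. r < length L \<Longrightarrow> s < length L \<Longrightarrow>
               w s * (L' ! s) r = (\<Sum>t<length L. l r t * (L ! s) t)"
  shows "col_det L' * (\<Prod>s<length L. w s) = (\<Prod>r<length L. l r r) * col_det L"
proof -
  define n where "n = length L"
  let ?W = "mat n n (\<lambda>(r, s). if r = s then w s else 0)"
  let ?T = "mat n n (\<lambda>(r, t). l r t)"
  have dW: "det ?W = (\<Prod>s<n. w s)"
    by (subst det_upper_triangular[of _ n])
       (auto simp: upper_triangular_def diag_mat_def prod.list_conv_set_nth
          lessThan_atLeast0 intro!: prod.cong)
  have dT: "det ?T = (\<Prod>s<n. l s s)"
    by (subst det_lower_triangular[of n])
       (auto simp: low diag_mat_def prod.list_conv_set_nth
          lessThan_atLeast0 intro!: prod.cong)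
  have car: "col_mat L \<in> carrier_mat n n" "col_mat L' \<in> carrier_mat n n"
    by (auto simp: n_def len col_mat_def)
  have "col_mat L' * ?W = ?T * col_mat L"
  proof (rule eq_matI)
    fix r s assume "r < dim_row (?T * col_mat L)" "s < dim_col (?T * col_mat L)"
    then have rs: "r < n" "s < n" by (auto simp: col_mat_def n_def)
    have "(col_mat L' * ?W) $$ (r, s) = (\<Sum>t<n. (L' ! t) r * (if t = s then w s else 0))"
      using rs len by (simp add: col_mat_def n_def scalar_prod_def lessThan_atLeast0)
    also have "\<dots> = w s * (L' ! s) r" using rs by (simp add: if_distrib cong: if_cong)
    also have "\<dots> = (\<Sum>t<n. l r t * (L ! s) t)" using eq rs by (simp add: n_def)
    also have "\<dots> = (?T * col_mat L) $$ (r, s)"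
      using rs by (simp add: col_mat_def n_def scalar_prod_def lessThan_atLeast0)
    finally show "(col_mat L' * ?W) $$ (r, s) = (?T * col_mat L) $$ (r, s)" .
  qed (auto simp: col_mat_def n_def len)
  then have "det (col_mat L' * ?W) = det (?T * col_mat L)" by simp
  then show ?thesis
    using car by (simp add: det_mult[of _ n] dW dT col_det_def flip: n_def)
qed

section \<open>Tilings of a region from which triangles are removed\<close>

lemma card_unit_triangle:
  assumes "t \<in> unit_triangles" shows "card t = 3"
  using assms by (auto simp: unit_triangles_def up_triangle_def down_triangle_def)

lemma finite_lozenge_tilings:
  assumes "finite Z" shows "finite (lozenge_tilings Z)"
proof -
  have "lozenge_tilings Z \<subseteq> Pow (Pow Z)"
    by (auto simp: lozenge_tilings_def partition_on_def)
  then show ?thesis using assms finite_subset by blast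
qed

lemma M_empty: "M {} = 1"
proof -
  have "lozenge_tilings {} = {{}}"
    by (auto simp: lozenge_tilings_def partition_on_empty)
  then show ?thesis by (simp add: M_def)
qed

lemma lozenge_tilings_insert:
  assumes Z: "Z \<subseteq> unit_triangles" and u: "u \<in> Z"
  shows "lozenge_tilings Z =
    (\<Union>v\<in>{v \<in> Z. card (u \<inter> v) = 2}. insert {u, v} ` lozenge_tilings (Z - {u, v}))"
proof (intro equalityI subsetI)
  fix T assume "T \<in> lozenge_tilings Z"
  then have T: "T \<subseteq> lozenges" "\<Union>T = Z" "disjoint T" "{} \<notin> T"
    by (auto simp: lozenge_tilings_def partition_on_def)
  obtain l where l: "l \<in> T" "u \<in> l" using T u by blast
  obtain s t where st: "l = {s, t}" "card (s \<inter> t) = 2"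
    using T l by (auto simp: lozenges_def)
  obtain v where v: "l = {u, v}" "card (u \<inter> v) = 2"
  proof (cases "u = s")
    case False
    then have "u = t" using st(1) l(2) by blast
    then show ?thesis using that[of s] st by (metis Int_commute insert_commute)
  qed (use that[of t] st in simp)
  have "\<Union>(T - {l}) = Z - {u, v}"
  proof -
    have "\<Union>(T - {l}) = \<Union>T - l"
      using T(3) l(1) unfolding disjoint_def by blast
    then show ?thesis by (simp only: T(2) v(1))
  qed
  moreover have "disjoint (T - {l})" using T(3) unfolding disjoint_def by blast
  moreover have "T - {l} \<subseteq> lozenges" "{} \<notin> T - {l}" using T(1,4) by blast+
  ultimately have "T - {l} \<in> lozenge_tilings (Z - {u, v})"
    unfolding lozenge_tilings_def partition_on_def by (intro CollectI conjI)
  moreover have "T = insert {u, v} (T - {l})" using l(1) v(1) by blast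
  moreover have "v \<in> Z" using T(2) l(1) v(1) by blast
  ultimately show "T \<in> (\<Union>v\<in>{v \<in> Z. card (u \<inter> v) = 2}. insert {u, v} ` lozenge_tilings (Z - {u, v}))"
    using v by blast
next
  fix T assume "T \<in> (\<Union>v\<in>{v \<in> Z. card (u \<inter> v) = 2}. insert {u, v} ` lozenge_tilings (Z - {u, v}))"
  then obtain v T' where v: "v \<in> Z" "card (u \<inter> v) = 2" and T: "T = insert {u, v} T'"
    and "T' \<in> lozenge_tilings (Z - {u, v})" by blast
  then have T': "T' \<subseteq> lozenges" "\<Union>T' = Z - {u, v}" "disjoint T'" "{} \<notin> T'"
    by (auto simp: lozenge_tilings_def partition_on_def)
  have "{u, v} \<in> lozenges" using u v Z unfolding lozenges_def by blast
  then have "T \<subseteq> lozenges" using T T'(1) by simp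
  moreover have "\<Union>T = Z" using T T'(2) u v(1) by auto
  moreover have "{u, v} \<inter> l = {}" if "l \<in> T'" for l using T'(2) that by blast
  then have "disjoint T" using T T'(3) unfolding disjoint_def by (metis Int_commute insert_iff)
  moreover have "{} \<notin> T" using T T'(4) by simp
  ultimately show "T \<in> lozenge_tilings Z"
    unfolding lozenge_tilings_def partition_on_def by (intro CollectI conjI)
qed

lemma M_remove:
  assumes fin: "finite Z" and Z: "Z \<subseteq> unit_triangles" and u: "u \<in> Z"
  shows "M Z = (\<Sum>v\<in>{v \<in> Z. card (u \<inter> v) = 2}. M (Z - {u, v}))"
proof -
  let ?N = "{v \<in> Z. card (u \<inter> v) = 2}"
  have notin: "l \<notin> T" if "u \<in> l" "T \<in> lozenge_tilings (Z - {u, v})" for l T v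
    using that by (auto simp: lozenge_tilings_def partition_on_def)
  have inj: "inj_on (insert {u, v}) (lozenge_tilings (Z - {u, v}))" for v
  proof (rule inj_onI)
    fix T T' assume "T \<in> lozenge_tilings (Z - {u, v})" "T' \<in> lozenge_tilings (Z - {u, v})"
      "insert {u, v} T = insert {u, v} T'"
    then show "T = T'" using notin[of "{u, v}"] by (metis insertI1 insert_ident)
  qed
  have "M Z = (\<Sum>v\<in>?N. card (insert {u, v} ` lozenge_tilings (Z - {u, v})))"
    unfolding M_def lozenge_tilings_insert[OF Z u]
  proof (rule card_UN_disjoint)
    show "\<forall>v\<in>?N. finite (insert {u, v} ` lozenge_tilings (Z - {u, v}))"
      using fin finite_lozenge_tilings by simp
    show "\<forall>v\<in>?N. \<forall>w\<in>?N. v \<noteq> w \<longrightarrow> insert {u, v} ` lozenge_tilings (Z - {u, v}) \<inter>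
        insert {u, w} ` lozenge_tilings (Z - {u, w}) = {}"
    proof (intro ballI impI equals0I)
      fix v w T assume vw: "v \<noteq> w"
        and T: "T \<in> insert {u, v} ` lozenge_tilings (Z - {u, v}) \<inter>
                insert {u, w} ` lozenge_tilings (Z - {u, w})"
      then obtain T1 where T1: "T = insert {u, v} T1" "T1 \<in> lozenge_tilings (Z - {u, v})"
        by blast
      obtain T2 where "T = insert {u, w} T2" using T by blast
      then have "{u, w} \<in> T" by simp
      then have "{u, w} = {u, v}" using notin[OF _ T1(2), of "{u, w}"] T1(1) by auto
      then show False using vw by (metis doubleton_eq_iff)
    qed
  qed (use fin in simp)
  then show ?thesis by (simp add: M_def card_image[OF inj])
qed

text \<open>Removing one forced pair can only shrink the neighbourhoods of the other
  \<open>d i\<close>, and by injectivity and disjointness their partners survive, so the pairs can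
  be removed one by one.\<close>

lemma M_remove_forced:
  assumes "finite J" "finite Z" "Z \<subseteq> unit_triangles"
    and "inj_on d J" "inj_on g J" "d ` J \<inter> g ` J = {}"
    and "\<And>i. i \<in> J \<Longrightarrow> d i \<in> Z \<and> g i \<in> Z \<and> {v \<in> Z. card (d i \<inter> v) = 2} = {g i}"
  shows "M Z = M (Z - d ` J - g ` J)"
  using assms
proof (induction J arbitrary: Z)
  case (insert i J)
  let ?Z = "Z - {d i, g i}"
  have i: "d i \<in> Z" "{v \<in> Z. card (d i \<inter> v) = 2} = {g i}" using insert.prems(6)[of i] by auto
  have "M Z = M ?Z"
    using M_remove[OF insert.prems(1,2) i(1)] by (simp add: i(2))
  also have "\<dots> = M (?Z - d ` J - g ` J)"
  proof (rule insert.IH)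
    fix i' assume i': "i' \<in> J"
    have "d i' \<noteq> d i" "d i' \<noteq> g i" "g i' \<noteq> d i" "g i' \<noteq> g i"
      using i' insert.hyps insert.prems(3,4,5) by (auto dest: inj_onD)
    then show "d i' \<in> ?Z \<and> g i' \<in> ?Z \<and> {v \<in> ?Z. card (d i' \<inter> v) = 2} = {g i'}"
      using insert.prems(6)[of i'] i' by auto
  qed (use insert.prems in auto)
  also have "?Z - d ` J - g ` J = Z - d ` insert i J - g ` insert i J" by auto
  finally show ?case .
qed simp

text \<open>
  Row \<open>i\<close> of strip \<open>c\<close>: the strips are bounded by the lattice lines \<open>p + q = c\<close> and
  \<open>p + q = c + 1\<close>, the row \<open>i\<close> by the horizontal lines at distance \<open>i - 1\<close> and \<open>i\<close> below the
  north side. The triangle \<open>down_at c i\<close> has an edge on the line \<open>p + q = c\<close>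
  and \<open>up_at c i\<close> has one on the line \<open>p + q = c + 1\<close>.
\<close>

definition up_at :: "int \<Rightarrow> int \<Rightarrow> unit_triangle" where
  "up_at c i = up_triangle (c + i) (- i)"

definition down_at :: "int \<Rightarrow> int \<Rightarrow> unit_triangle" where
  "down_at c i = down_triangle (c + i - 1) (1 - i)"

lemma up_at_vertices: "up_at c i = {(c + i, - i), (c + i + 1, - i), (c + i, 1 - i)}"
  by (simp add: up_at_def up_triangle_def)

lemma down_at_vertices: "down_at c i = {(c + i - 1, 1 - i), (c + i, 1 - i), (c + i, - i)}"
  by (simp add: down_at_def down_triangle_def)

lemma unit_triangles_cases:
  assumes "t \<in> unit_triangles"
  obtains c i where "t = up_at c i" | c i where "t = down_at c i"
proof -
  from assms obtain p q where "t = up_triangle p q \<or> t = down_triangle p q"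
    by (auto simp: unit_triangles_def)
  moreover have "up_triangle p q = up_at (p + q) (- q)" by (simp add: up_at_def)
  moreover have "down_triangle p q = down_at (p + q) (1 - q)" by (simp add: down_at_def)
  ultimately show thesis using that by metis
qed

lemma at_in_unit_triangles [simp]: "up_at c i \<in> unit_triangles" "down_at c i \<in> unit_triangles"
  by (auto simp: up_at_def down_at_def unit_triangles_def)

lemma up_at_eq_iff [simp]: "up_at c i = up_at c' i' \<longleftrightarrow> c = c' \<and> i = i'"
proof
  assume eq: "up_at c i = up_at c' i'"
  have "(c + i, - i) \<in> up_at c i" "(c + i + 1, - i) \<in> up_at c i" "(c + i, 1 - i) \<in> up_at c i"
    by (simp_all add: up_at_vertices)
  then show "c = c' \<and> i = i'" unfolding eq by (auto simp: up_at_vertices)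
qed simp

lemma down_at_eq_iff [simp]: "down_at c i = down_at c' i' \<longleftrightarrow> c = c' \<and> i = i'"
proof
  assume eq: "down_at c i = down_at c' i'"
  have "(c + i - 1, 1 - i) \<in> down_at c i" "(c + i, 1 - i) \<in> down_at c i" "(c + i, - i) \<in> down_at c i"
    by (simp_all add: down_at_vertices)
  then show "c = c' \<and> i = i'" unfolding eq by (auto simp: down_at_vertices)
qed simp

lemma up_at_neq_down_at [simp]: "up_at c i \<noteq> down_at c' i'" "down_at c' i' \<noteq> up_at c i"
proof -
  show "up_at c i \<noteq> down_at c' i'"
  proof
    assume eq: "up_at c i = down_at c' i'"
    have "(c + i, - i) \<in> up_at c i" "(c + i + 1, - i) \<in> up_at c i" "(c + i, 1 - i) \<in> up_at c i"
      by (simp_all add: up_at_vertices)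
    then show False unfolding eq by (auto simp: down_at_vertices)
  qed
  then show "down_at c' i' \<noteq> up_at c i" by metis
qed

text \<open>Two of the three neighbours of an upward triangle lie in its own strip, in rows
  \<open>i\<close> and \<open>i + 1\<close>; only the third lies across a strip line. The two
  choices inside the strip become the two terms of Pascal's rule.\<close>

lemma card_up_at_Int_down_at:
  "card (up_at c i \<inter> down_at c' i') = 2 \<longleftrightarrow> c' = c \<and> i' = i \<or> c' = c \<and> i' = i + 1 \<or> c' = c + 1 \<and> i' = i"
proof
  assume "card (up_at c i \<inter> down_at c' i') = 2"
  then obtain u v where eq: "up_at c i \<inter> down_at c' i' = {u, v}" and neq: "u \<noteq> v"
    unfolding card_2_iff by blast
  obtain u1 u2 v1 v2 where uv: "u = (u1, u2)" "v = (v1, v2)" by fastforce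
  have "u \<in> up_at c i \<inter> down_at c' i'" "v \<in> up_at c i \<inter> down_at c' i'"
    unfolding eq by simp_all
  then have "(u1, u2) \<in> up_at c i" "(v1, v2) \<in> up_at c i"
      "(u1, u2) \<in> down_at c' i'" "(v1, v2) \<in> down_at c' i'" "\<not> (u1 = v1 \<and> u2 = v2)"
    using neq by (simp_all add: uv)
  then show "c' = c \<and> i' = i \<or> c' = c \<and> i' = i + 1 \<or> c' = c + 1 \<and> i' = i"
    unfolding up_at_vertices down_at_vertices insert_iff empty_iff prod.inject by smt
next
  have "up_at c i \<inter> down_at c i = {(c + i, - i), (c + i, 1 - i)}"
    "up_at c i \<inter> down_at c (i + 1) = {(c + i, - i), (c + i + 1, - i)}"
    "up_at c i \<inter> down_at (c + 1) i = {(c + i + 1, - i), (c + i, 1 - i)}"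
    unfolding up_at_vertices down_at_vertices by auto
  then have "card (up_at c i \<inter> down_at c i) = 2" "card (up_at c i \<inter> down_at c (i + 1)) = 2"
    "card (up_at c i \<inter> down_at (c + 1) i) = 2"
    by simp_all
  moreover assume "c' = c \<and> i' = i \<or> c' = c \<and> i' = i + 1 \<or> c' = c + 1 \<and> i' = i"
  ultimately show "card (up_at c i \<inter> down_at c' i') = 2" by blast
qed

lemma card_up_at_Int_up_at: "card (up_at c i \<inter> up_at c' i') \<noteq> 2"
proof
  assume two: "card (up_at c i \<inter> up_at c' i') = 2"
  then obtain u v where eq: "up_at c i \<inter> up_at c' i' = {u, v}" and neq: "u \<noteq> v"
    unfolding card_2_iff by blast
  obtain u1 u2 v1 v2 where uv: "u = (u1, u2)" "v = (v1, v2)" by fastforce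
  have "u \<in> up_at c i \<inter> up_at c' i'" "v \<in> up_at c i \<inter> up_at c' i'"
    unfolding eq by simp_all
  then have "(u1, u2) \<in> up_at c i" "(v1, v2) \<in> up_at c i"
      "(u1, u2) \<in> up_at c' i'" "(v1, v2) \<in> up_at c' i'" "\<not> (u1 = v1 \<and> u2 = v2)"
    using neq by (simp_all add: uv)
  then have "c = c' \<and> i = i'"
    unfolding up_at_vertices insert_iff empty_iff prod.inject by smt
  then show False using two card_unit_triangle[of "up_at c i"] by simp
qed

lemma card_down_at_Int_down_at: "card (down_at c i \<inter> down_at c' i') \<noteq> 2"
proof
  assume two: "card (down_at c i \<inter> down_at c' i') = 2"
  then obtain u v where eq: "down_at c i \<inter> down_at c' i' = {u, v}" and neq: "u \<noteq> v"
    unfolding card_2_iff by blast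
  obtain u1 u2 v1 v2 where uv: "u = (u1, u2)" "v = (v1, v2)" by fastforce
  have "u \<in> down_at c i \<inter> down_at c' i'" "v \<in> down_at c i \<inter> down_at c' i'"
    unfolding eq by simp_all
  then have "(u1, u2) \<in> down_at c i" "(v1, v2) \<in> down_at c i"
      "(u1, u2) \<in> down_at c' i'" "(v1, v2) \<in> down_at c' i'" "\<not> (u1 = v1 \<and> u2 = v2)"
    using neq by (simp_all add: uv)
  then have "c = c' \<and> i = i'"
    unfolding down_at_vertices insert_iff empty_iff prod.inject by smt
  then show False using two card_unit_triangle[of "down_at c i"] by simp
qed

section \<open>The number of tilings as a determinant\<close>

text \<open>A negative upper argument belongs to a path that would start beyond the line it has to
  reach, hence the value 0. The price is that Pascal's rule fails for \<open>p = - 1\<close> and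
  \<open>q = 0\<close>.\<close>

definition binomial_int :: "int \<Rightarrow> int \<Rightarrow> real" where
  "binomial_int p q = (if 0 \<le> p \<and> 0 \<le> q then real (nat p choose nat q) else 0)"

lemma binomial_int_pascal:
  assumes "0 \<le> p"
  shows "binomial_int (p + 1) q = binomial_int p q + binomial_int p (q - 1)"
proof (cases "q \<le> 0")
  case True
  then show ?thesis using assms by (cases "q = 0") (auto simp: binomial_int_def)
next
  case False
  then have "nat (p + 1) = Suc (nat p)" "nat q = Suc (nat (q - 1))" using assms by auto
  then show ?thesis using assms False by (simp add: binomial_int_def)
qed

lemma binomial_int_eq_0: "q < 0 \<or> p < q \<Longrightarrow> binomial_int p q = 0"
  by (auto simp: binomial_int_def intro!: binomial_eq_0)

text \<open>
  The entry in row \<open>r\<close> counts the lattice paths from row \<open>2 * (r + 1)\<close> of the line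
  \<open>p + q = - (r + 1)\<close>, where the \<open>(r + 1)\<close>-st bump of the zigzag side has an edge,
  to row \<open>i\<close> of the line \<open>p + q = c\<close>.
\<close>

definition path_col :: "int \<Rightarrow> int \<Rightarrow> nat \<Rightarrow> real" where
  "path_col c i r = binomial_int (c + int r + 1) (2 * (int r + 1) - i)"

context
  fixes a k x :: nat
begin

text \<open>The conjuncts stand for the north, south, zigzag, northeast and southeast sides, in this
  order.\<close>

definition up_in :: "int \<Rightarrow> int \<Rightarrow> bool" where
  "up_in c i \<longleftrightarrow> 1 \<le> i \<and> i \<le> 2 * int (a + k) \<and> - 2 * c - 1 \<le> i \<and> c < int x
     \<and> c + i + 1 \<le> int (x + a + 2 * k)"

definition down_in :: "int \<Rightarrow> int \<Rightarrow> bool" where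
  "down_in c i \<longleftrightarrow> 1 \<le> i \<and> i \<le> 2 * int (a + k) \<and> - 2 * c \<le> i \<and> c < int x
     \<and> c + i \<le> int (x + a + 2 * k)"

lemma enclosed_points_iff:
  "(p, q) \<in> enclosed_points a k x \<longleftrightarrow> - 2 * int (a + k) \<le> q \<and> q \<le> 0 \<and>
     - q \<le> 2 * p + 1 \<and> p + q \<le> int x \<and> p \<le> int (x + a + 2 * k)"
proof -
  have "(p, q) \<in> enclosed_points a k x \<longleftrightarrow> 0 \<le> - q \<and> - q \<le> int (2 * a + 2 * k) \<and>
     west_boundary (- q) \<le> p \<and> p \<le> east_boundary a k x (- q)"
    by (auto simp: enclosed_points_def intro!: exI[of _ "- q"])
  moreover have "west_boundary (- q) \<le> p \<longleftrightarrow> - q \<le> 2 * p + 1"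
    unfolding west_boundary_def by linarith
  ultimately show ?thesis by (auto simp: east_boundary_def)
qed

lemma up_at_enclosed: "up_at c i \<in> enclosed_triangles a k x \<longleftrightarrow> up_in c i"
proof -
  have "up_at c i \<in> enclosed_triangles a k x \<longleftrightarrow> up_at c i \<subseteq> enclosed_points a k x"
    by (simp add: enclosed_triangles_def)
  also have "\<dots> \<longleftrightarrow> up_in c i"
    unfolding up_at_vertices up_in_def by (auto simp: enclosed_points_iff)
  finally show ?thesis .
qed

lemma down_at_enclosed: "down_at c i \<in> enclosed_triangles a k x \<longleftrightarrow> down_in c i"
proof -
  have "down_at c i \<in> enclosed_triangles a k x \<longleftrightarrow> down_at c i \<subseteq> enclosed_points a k x"
    by (simp add: enclosed_triangles_def)
  also have "\<dots> \<longleftrightarrow> down_in c i"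
    unfolding down_at_vertices down_in_def by (auto simp: enclosed_points_iff)
  finally show ?thesis .
qed

text \<open>A snapshot of the sweep that starts at the northeast side. The two sets have opposite
  sense: \<open>S\<close> lists upward triangles that remain, \<open>T\<close> downward triangles
  that are gone, so a fresh strip has \<open>T\<close> empty.\<close>

definition strip_region :: "int \<Rightarrow> int set \<Rightarrow> int set \<Rightarrow> unit_triangle set" where
  "strip_region c T S =
     {up_at c' i | c' i. up_in c' i \<and> (c' < c \<or> c' = c \<and> i \<in> S)} \<union>
     {down_at c' i | c' i. down_in c' i \<and> (c' < c \<or> c' = c \<and> i \<notin> T)}"

lemma up_at_strip_region [simp]:
  "up_at c' i \<in> strip_region c T S \<longleftrightarrow> up_in c' i \<and> (c' < c \<or> c' = c \<and> i \<in> S)"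
  by (auto simp: strip_region_def)

lemma down_at_strip_region [simp]:
  "down_at c' i \<in> strip_region c T S \<longleftrightarrow> down_in c' i \<and> (c' < c \<or> c' = c \<and> i \<notin> T)"
  by (auto simp: strip_region_def)

lemma strip_region_subset: "strip_region c T S \<subseteq> unit_triangles"
  by (auto simp: strip_region_def)

lemma unit_triangle_set_eqI:
  assumes "A \<subseteq> unit_triangles" "B \<subseteq> unit_triangles"
    and "\<And>c i. up_at c i \<in> A \<longleftrightarrow> up_at c i \<in> B" "\<And>c i. down_at c i \<in> A \<longleftrightarrow> down_at c i \<in> B"
  shows "A = B"
proof (rule Set.set_eqI)
  fix t show "t \<in> A \<longleftrightarrow> t \<in> B"
  proof (cases "t \<in> unit_triangles")
    case True
    then show ?thesis by (rule unit_triangles_cases) (simp_all add: assms)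
  qed (use assms in blast)
qed

lemma finite_strip_region: "finite (strip_region c T S)"
proof -
  let ?C = "{- int (2 * (a + k)) - 1..int x} \<times> {1..2 * int (a + k)}"
  have "strip_region c T S \<subseteq> case_prod up_at ` ?C \<union> case_prod down_at ` ?C"
  proof
    fix t assume t: "t \<in> strip_region c T S"
    then have "t \<in> unit_triangles" using strip_region_subset by blast
    then show "t \<in> case_prod up_at ` ?C \<union> case_prod down_at ` ?C"
    proof (rule unit_triangles_cases)
      fix c' i assume "t = up_at c' i"
      then show ?thesis using t by (intro UnI1 image_eqI[of _ _ "(c', i)"]) (auto simp: up_in_def)
    next
      fix c' i assume "t = down_at c' i"
      then show ?thesis using t by (intro UnI2 image_eqI[of _ _ "(c', i)"]) (auto simp: down_in_def)
    qed
  qed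
  then show ?thesis by (rule finite_subset) simp
qed

text \<open>The neighbour across the line \<open>p + q = c + 1\<close> lies in a strip that is
  already removed, which leaves the two neighbours in strip \<open>c\<close>.\<close>

lemma M_strip_region_up:
  assumes "s \<notin> S" "up_in c s"
  shows "M (strip_region c T (insert s S)) =
    (\<Sum>i\<in>{s, s + 1}. if down_in c i \<and> i \<notin> T then M (strip_region c (insert i T) S) else 0)"
proof -
  let ?Z = "strip_region c T (insert s S)"
  let ?I = "{i \<in> {s, s + 1}. down_in c i \<and> i \<notin> T}"
  have "{v \<in> ?Z. card (up_at c s \<inter> v) = 2} = down_at c ` ?I"
  proof (rule unit_triangle_set_eqI)
    show "{v \<in> ?Z. card (up_at c s \<inter> v) = 2} \<subseteq> unit_triangles"
      using strip_region_subset by blast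
  qed (auto simp: card_up_at_Int_down_at card_up_at_Int_up_at)
  moreover have "(\<Sum>i\<in>?I. M (?Z - {up_at c s, down_at c i})) = (\<Sum>i\<in>?I. M (strip_region c (insert i T) S))"
  proof (intro sum.cong arg_cong[of _ _ M] refl)
    fix i assume i: "i \<in> ?I"
    show "?Z - {up_at c s, down_at c i} = strip_region c (insert i T) S"
      by (rule unit_triangle_set_eqI) (use i strip_region_subset assms in auto)
  qed
  moreover have "inj_on (down_at c) ?I" by (rule inj_onI) simp
  ultimately have "M ?Z = (\<Sum>i\<in>?I. M (strip_region c (insert i T) S))"
    using M_remove[OF finite_strip_region strip_region_subset, of "up_at c s" c T "insert s S"] assms
    by (simp add: sum.reindex)
  also have "\<dots> = (\<Sum>i\<in>{s, s + 1}. if down_in c i \<and> i \<notin> T then M (strip_region c (insert i T) S) else 0)"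
    by (rule sum.inter_filter) simp
  finally show ?thesis .
qed

text \<open>The edge of the bump triangle on \<open>p + q = c\<close> is a boundary edge and the
  upward triangles of its strip are gone, so it has no partner.\<close>

lemma M_strip_region_no_start:
  assumes "c \<le> - 1" "- int (a + k) \<le> c" "- 2 * c \<notin> T"
  shows "M (strip_region c T {}) = 0"
proof -
  let ?Z = "strip_region c T {}"
  have empty: "{v \<in> ?Z. card (down_at c (- 2 * c) \<inter> v) = 2} = {}"
  proof (rule unit_triangle_set_eqI)
    show "{v \<in> ?Z. card (down_at c (- 2 * c) \<inter> v) = 2} \<subseteq> unit_triangles"
      using strip_region_subset by blast
  qed (auto simp: card_up_at_Int_down_at Int_commute[of "down_at _ _" "up_at _ _"]
        card_down_at_Int_down_at up_in_def)
  have "down_at c (- 2 * c) \<in> ?Z"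
    using assms by (auto simp: down_in_def)
  from M_remove[OF finite_strip_region strip_region_subset this]
  show ?thesis unfolding empty by simp
qed

text \<open>Without upward triangles in strip \<open>c\<close>, each downward triangle left there
  must pair across the line \<open>p + q = c\<close>, and the rows of \<open>T\<close> stay open in
  strip \<open>c - 1\<close>. The bump row \<open>- 2 * c\<close> is taken out because the region
  has no upward triangle there.\<close>

lemma M_strip_region_forced:
  assumes "c < int x" "- int (a + k) \<le> c" "c \<le> - 1 \<longrightarrow> - 2 * c \<in> T" "\<And>i. i \<in> T \<Longrightarrow> down_in c i"
  shows "M (strip_region c T {}) = M (strip_region (c - 1) {} (T - {- 2 * c}))"
proof -
  let ?Z = "strip_region c T {}"
  let ?J = "{i. down_in c i \<and> i \<notin> T}"
  have fin: "finite ?J"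
    by (rule finite_subset[of _ "{1..2 * int (a + k)}"]) (auto simp: down_in_def)
  have up: "up_in (c - 1) i \<longleftrightarrow> down_in c i \<and> i \<noteq> - 2 * c" for i
    using assms(1) by (auto simp: up_in_def down_in_def)
  have "M ?Z = M (?Z - down_at c ` ?J - up_at (c - 1) ` ?J)"
  proof (rule M_remove_forced[OF fin finite_strip_region strip_region_subset])
    fix i assume i: "i \<in> ?J"
    then have ne: "i \<noteq> - 2 * c" using assms(3) by (auto simp: down_in_def)
    have "{v \<in> ?Z. card (down_at c i \<inter> v) = 2} = {up_at (c - 1) i}"
    proof (rule unit_triangle_set_eqI)
      show "{v \<in> ?Z. card (down_at c i \<inter> v) = 2} \<subseteq> unit_triangles"
        using strip_region_subset by blast
    qed (use i ne in \<open>auto simp: card_up_at_Int_down_at Int_commute[of "down_at _ _" "up_at _ _"]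
          card_down_at_Int_down_at up\<close>)
    then show "down_at c i \<in> ?Z \<and> up_at (c - 1) i \<in> ?Z \<and>
        {v \<in> ?Z. card (down_at c i \<inter> v) = 2} = {up_at (c - 1) i}"
      using i ne by (simp add: up)
  qed (auto intro: inj_onI)
  also have "?Z - down_at c ` ?J - up_at (c - 1) ` ?J = strip_region (c - 1) {} (T - {- 2 * c})"
  proof (rule unit_triangle_set_eqI)
    fix c' i
    show "up_at c' i \<in> ?Z - down_at c ` ?J - up_at (c - 1) ` ?J
        \<longleftrightarrow> up_at c' i \<in> strip_region (c - 1) {} (T - {- 2 * c})"
      by (cases "c' = c - 1") (use assms(4) in \<open>auto simp: up image_iff\<close>)
    show "down_at c' i \<in> ?Z - down_at c ` ?J - up_at (c - 1) ` ?J
        \<longleftrightarrow> down_at c' i \<in> strip_region (c - 1) {} (T - {- 2 * c})"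
      by (cases "c' = c - 1") (auto simp: image_iff)
  qed (use strip_region_subset in auto)
  finally show ?thesis .
qed

text \<open>
  Rows \<open>T\<close> of strip \<open>c\<close> are already used by the paths, rows \<open>S\<close> of its upward triangles are still to be
  matched. Matching \<open>up_at c s\<close> with one of the two downward triangles of its strip is Pascal's rule
  for the column of \<open>s\<close>; a choice that is already taken yields two equal columns. When
  \<open>S\<close> is exhausted, the remaining tiling between the strips \<open>c\<close> and \<open>c - 1\<close> is forced, except that the
  start of a new path, in row \<open>- 2 * c\<close>, has to be used.
\<close>

lemma M_strip_region_step:
  assumes c: "- int (a + k) \<le> c" "c < int x"
    and IH: "\<And>S. sorted_wrt (<) S \<Longrightarrow> \<forall>i\<in>set S. up_in (c - 1) i \<Longrightarrow> nat (- c) + length S = a + k \<Longrightarrow>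
      real (M (strip_region (c - 1) {} (set S)))
        = col_det (map unit_col [0..<nat (- c)] @ map (path_col c) S)"
  shows "sorted_wrt (<) T \<Longrightarrow> sorted_wrt (<) S \<Longrightarrow> \<forall>t\<in>set T. \<forall>s\<in>set S. t \<le> s \<Longrightarrow>
    \<forall>t\<in>set T. down_in c t \<Longrightarrow> \<forall>s\<in>set S. up_in c s \<Longrightarrow>
    nat (- c - 1) + length T + length S = a + k \<Longrightarrow>
    real (M (strip_region c (set T) (set S)))
      = col_det (map unit_col [0..<nat (- c - 1)] @ map (path_col c) T @ map (path_col (c + 1)) S)"
proof (induction S arbitrary: T)
  case (Cons s S)
  let ?A = "map unit_col [0..<nat (- c - 1)] @ map (path_col c) T"
  let ?B = "map (path_col (c + 1)) S"
  have s: "up_in c s" "s \<notin> set S" using Cons.prems by auto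
  have summand: "real (if down_in c i \<and> i \<notin> set T then M (strip_region c (insert i (set T)) (set S)) else 0)
      = col_det (?A @ path_col c i # ?B)" if i: "i \<in> {s, s + 1}" for i
  proof -
    consider (new) "down_in c i" "i \<notin> set T" | (out) "\<not> down_in c i" | (old) "i \<in> set T" by blast
    then show ?thesis
    proof cases
      case new
      have "real (M (strip_region c (set (T @ [i])) (set S)))
        = col_det (map unit_col [0..<nat (- c - 1)] @ map (path_col c) (T @ [i]) @ ?B)"
      proof (rule Cons.IH)
        have "t < i" if "t \<in> set T" for t
        proof -
          have "t \<le> s" using that Cons.prems(3) by simp
          moreover have "t \<noteq> i" using that new by blast
          ultimately show ?thesis using i by auto
        qed
        then show "sorted_wrt (<) (T @ [i])" using Cons.prems(1) by (simp add: sorted_wrt_append)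
        show "\<forall>t\<in>set (T @ [i]). \<forall>s\<in>set S. t \<le> s"
          using Cons.prems(2,3) i by force
      qed (use Cons.prems new in auto)
      then show ?thesis using new by simp
    next
      case out
      have "path_col c i r = 0" if "r < a + k" for r
      proof -
        \<comment> \<open>The choice leaves the region either below the south side or through the
          zigzag, in row \<open>- 2 * c - 1\<close>.\<close>
        have "2 * (int r + 1) < i \<or> i = - 2 * c - 1"
          using out s(1) i that by (auto simp: up_in_def down_in_def)
        then have "c + int r + 1 < 0 \<or> 2 * (int r + 1) - i < 0 \<or> c + int r + 1 < 2 * (int r + 1) - i"
          by presburger
        then show ?thesis
          unfolding path_col_def by (auto intro: binomial_int_eq_0 simp: binomial_int_def)
      qed
      moreover have "length (?A @ path_col c i # ?B) = a + k" using Cons.prems(6) by simp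
      ultimately have "col_det (?A @ path_col c i # ?B) = 0"
        by (intro col_det_zero_col) simp
      then show ?thesis using out by simp
    next
      case old
      then have "col_det (?A @ path_col c i # ?B) = 0"
        by (intro col_det_not_distinct) auto
      then show ?thesis using old by simp
    qed
  qed
  have pascal: "path_col (c + 1) s = (\<lambda>r. path_col c s r + path_col c (s + 1) r)"
  proof
    fix r
    show "path_col (c + 1) s r = path_col c s r + path_col c (s + 1) r"
    proof (cases "0 \<le> c + int r + 1")
      case True
      then show ?thesis
        using binomial_int_pascal[of "c + int r + 1" "2 * (int r + 1) - s"]
        by (simp add: path_col_def algebra_simps)
    next
      case False
      then have "2 * (int r + 1) - s < 0" using s(1) by (auto simp: up_in_def)
      then show ?thesis by (simp add: path_col_def binomial_int_eq_0)
    qed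
  qed
  have "real (M (strip_region c (set T) (set (s # S))))
      = (\<Sum>i\<in>{s, s + 1}. col_det (?A @ path_col c i # ?B))"
    using s summand by (simp add: M_strip_region_up)
  also have "\<dots> = col_det (?A @ path_col (c + 1) s # ?B)"
    unfolding pascal col_det_add by simp
  finally show ?case by simp
next
  case Nil
  note T = Nil.prems(1,4,6)
  consider (right) "0 \<le> c" | (none) "c \<le> - 1" "- 2 * c \<notin> set T" | (start) "c \<le> - 1" "- 2 * c \<in> set T"
    by linarith
  then show ?case
  proof cases
    case right
    then have "set T - {- 2 * c} = set T" using T(2) by (force simp: down_in_def)
    then have "M (strip_region c (set T) {}) = M (strip_region (c - 1) {} (set T))"
      using M_strip_region_forced[of c "set T"] c T right by simp
    moreover have "\<forall>i\<in>set T. up_in (c - 1) i"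
      using T(2) right by (auto simp: up_in_def down_in_def)
    ultimately show ?thesis using IH[of T] T right by simp
  next
    case none
    let ?L = "map unit_col [0..<nat (- c - 1)] @ map (path_col c) T"
    \<comment> \<open>Matrix row \<open>nat (- c - 1)\<close> belongs to the bump in lattice row
      \<open>- 2 * c\<close> of this strip, and all of \<open>T\<close> lies below that row, out of
      reach.\<close>
    have "col_det ?L = 0"
    proof (rule col_det_zero_row)
      show "nat (- c - 1) < length ?L" using T(3) c none by auto
      fix i assume i: "i < length ?L"
      show "(?L ! i) (nat (- c - 1)) = 0"
      proof (cases "i < nat (- c - 1)")
        case True
        then show ?thesis by (simp add: nth_append unit_col_def)
      next
        case False
        let ?t = "T ! (i - nat (- c - 1))"
        have "?t \<in> set T" using i False by (intro nth_mem) auto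
        then have "down_in c ?t" "?t \<noteq> - 2 * c" using T(2) none(2) by metis+
        then have "- 2 * c < ?t" by (simp add: down_in_def)
        then have "path_col c ?t (nat (- c - 1)) = 0"
          using none by (simp add: path_col_def binomial_int_eq_0)
        then show ?thesis using i False by (simp add: nth_append)
      qed
    qed
    then show ?thesis using M_strip_region_no_start none c by simp
  next
    case start
    obtain t T' where tT: "T = t # T'" using start by (cases T) auto
    have lt: "\<forall>t'\<in>set T'. t < t'" and sorted': "sorted_wrt (<) T'" using T(1) tT by auto
    have "down_in c t" "- 2 * c = t \<or> - 2 * c \<in> set T'" using T(2) start(2) by (simp_all add: tT)
    then have t: "t = - 2 * c" using lt by (auto simp: down_in_def)
    have "set T - {- 2 * c} = set T'" using lt unfolding tT t by auto
    then have "M (strip_region c (set T) {}) = M (strip_region (c - 1) {} (set T'))"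
      using M_strip_region_forced[of c "set T"] c T start by simp
    moreover have "\<forall>i\<in>set T'. up_in (c - 1) i"
      using T(2) lt t tT by (auto simp: up_in_def down_in_def)
    moreover have n: "nat (- c) = Suc (nat (- c - 1))" using start by auto
    \<comment> \<open>A path of length zero: with \<open>z = c + r + 1\<close> the entry is
      \<open>binomial z (2 * z)\<close>, which is nonzero only for \<open>z = 0\<close>.\<close>
    moreover have "path_col c t = unit_col (nat (- c - 1))"
    proof
      fix r show "path_col c t r = unit_col (nat (- c - 1)) r"
      proof (cases "c + int r + 1 \<le> 0")
        case True
        then show ?thesis using start t
          by (auto simp: path_col_def unit_col_def binomial_int_def)
      next
        case False
        then have "path_col c t r = 0"
          using t unfolding path_col_def by (intro binomial_int_eq_0) simp
        then show ?thesis using False start by (auto simp: unit_col_def)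
      qed
    qed
    ultimately show ?thesis using IH[of T'] T sorted' tT by simp
  qed
qed

text \<open>Induction from the southwest, where the region is empty and the matrix is the identity.
  The unit columns stand for the bumps \<open>r < nat (- c)\<close>, whose paths start outside the
  remaining region; they keep the number of columns at \<open>a + k\<close>.\<close>

lemma M_strip_region:
  assumes "- int (a + k) \<le> c" "c \<le> int x" "sorted_wrt (<) S" "\<forall>i\<in>set S. up_in (c - 1) i"
    "nat (- c) + length S = a + k"
  shows "real (M (strip_region (c - 1) {} (set S)))
        = col_det (map unit_col [0..<nat (- c)] @ map (path_col c) S)"
  using assms
proof (induction c arbitrary: S rule: int_ge_induct)
  case base
  have "nat (- (- int (a + k))) = a + k" by simp
  then have "S = []" using base by (simp del: of_nat_add minus_add_distrib)
  moreover have "strip_region (- int (a + k) - 1) {} {} = {}"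
    by (rule unit_triangle_set_eqI) (auto simp: up_in_def down_in_def strip_region_subset)
  ultimately show ?case by (simp add: M_empty col_det_unit_cols del: of_nat_add)
next
  case (step c)
  have "real (M (strip_region c (set []) (set S)))
      = col_det (map unit_col [0..<nat (- c - 1)] @ map (path_col c) [] @ map (path_col (c + 1)) S)"
    by (rule M_strip_region_step) (use step in \<open>auto simp: algebra_simps\<close>)
  then show ?case by simp
qed

text \<open>The removed triangles are upward triangles of the last strip \<open>c = x - 1\<close>,
  so \<open>R\<close> is itself a region of the sweep. In that strip the southeast bound of
  \<open>up_in\<close> reads \<open>i <= a + 2 * k\<close>.\<close>

lemma M_R_eq_col_det:
  assumes "1 \<le> j" "j \<le> a + k + 1"
  shows "real (M (R a k j x)) = col_det (map (path_col (int x)) (map int ([1..<j] @ [j + k..<a + 2 * k + 1])))"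
proof -
  let ?S = "map int ([1..<j] @ [j + k..<a + 2 * k + 1])"
  have sorted: "sorted_wrt (<) ?S"
    by (auto simp: sorted_wrt_map sorted_wrt_append)
  have up: "\<forall>i\<in>set ?S. up_in (int x - 1) i"
    using assms by (auto simp: up_in_def)
  have ne: "ne_triangle x i = up_at (int x - 1) (int i)" for i
    by (simp add: ne_triangle_def up_at_def algebra_simps)
  define X where "X = set ?S"
  have X: "int n \<in> X \<longleftrightarrow> n \<notin> {j..<j + k}" if "1 \<le> n" "n \<le> a + 2 * k" for n
  proof -
    have "X = int ` ({1..<j} \<union> {j + k..<a + 2 * k + 1})"
      by (simp only: X_def set_map set_append set_upt)
    then have "int n \<in> X \<longleftrightarrow> n \<in> {1..<j} \<union> {j + k..<a + 2 * k + 1}"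
      by (metis (no_types) image_iff of_nat_eq_iff)
    then show ?thesis using that by auto
  qed
  have "R a k j x = strip_region (int x - 1) {} X"
  proof (rule unit_triangle_set_eqI)
    fix c i
    show "up_at c i \<in> R a k j x \<longleftrightarrow> up_at c i \<in> strip_region (int x - 1) {} X"
    proof (cases "up_in c i \<and> c = int x - 1")
      case True
      then obtain n where n: "i = int n" "1 \<le> n" "n \<le> a + 2 * k"
        by (auto simp: up_in_def intro: that[of "nat i"])
      have "up_at c i \<in> R a k j x \<longleftrightarrow> n \<notin> {j..<j + k}"
        using True by (auto simp: R_def up_at_enclosed ne n(1) image_iff)
      then show ?thesis using True X[OF n(2,3)] n(1) by auto
    next
      case False
      moreover have "up_at c i \<in> R a k j x \<longleftrightarrow> up_in c i" if "c \<noteq> int x - 1"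
        using that by (auto simp: R_def up_at_enclosed ne)
      moreover have "up_at c i \<in> R a k j x \<Longrightarrow> up_in c i"
        by (simp add: R_def up_at_enclosed)
      moreover have "up_in c i \<Longrightarrow> c < int x" by (simp add: up_in_def)
      ultimately show ?thesis by auto
    qed
    have "down_in c i \<Longrightarrow> c < int x" by (simp add: down_in_def)
    then show "down_at c i \<in> R a k j x \<longleftrightarrow> down_at c i \<in> strip_region (int x - 1) {} X"
      by (auto simp: R_def down_at_enclosed ne)
  qed (auto simp: R_def enclosed_triangles_def intro: subsetD[OF strip_region_subset])
  moreover have len: "nat (- int x) + length ?S = a + k" using assms by auto
  have "real (M (strip_region (int x - 1) {} (set ?S)))
      = col_det (map unit_col [0..<nat (- int x)] @ map (path_col (int x)) ?S)"
    by (rule M_strip_region[OF _ _ sorted up len]) simp_all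
  moreover have "map unit_col [0..<nat (- int x)] = []" by simp
  ultimately show ?thesis unfolding X_def by (simp only: append_Nil)
qed

end

section \<open>Evaluation of the determinant\<close>

lemma binomial_absorb_real:
  "real (Suc p) * real (z choose Suc p) = (real z - real p) * real (z choose p)"
proof (cases "p \<le> z")
  case True
  have "Suc p * (z choose Suc p) = (z - p) * (z choose p)"
    by (simp only: binomial_absorption binomial_absorb_comp)
  then have "real (Suc p * (z choose Suc p)) = real ((z - p) * (z choose p))" by simp
  then show ?thesis by (simp only: of_nat_mult of_nat_diff[OF True])
qed (simp add: binomial_eq_0)

text \<open>For \<open>y = x + r + 1\<close> and \<open>q = 2 * (r + 1) - i\<close> the factors on
  the left are \<open>2 * x + i + 2\<close> and \<open>2 * x + i + 1\<close>, free of
  \<open>r\<close>, and those on the right are free of \<open>i\<close>. The binomials on the right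
  are the entries for \<open>x\<close> in rows \<open>r\<close> and \<open>r - 1\<close>.\<close>

lemma binomial_int_shift:
  assumes "1 \<le> y"
  shows "(2 * real_of_int y - real_of_int q + 2) * (2 * real_of_int y - real_of_int q + 1) * binomial_int (y + 1) q
    = (2 * real_of_int y + 2) * (2 * real_of_int y + 1) * binomial_int y q
      + real_of_int y * (real_of_int y + 1) * binomial_int (y - 1) (q - 2)"
proof -
  define z where "z = nat (y - 1)"
  have y: "y = int z + 1" using assms by (simp add: z_def)
  consider "q < 0" | "q = 0" | "q = 1" | p where "q = int p + 2"
  proof -
    assume *: "q < 0 \<Longrightarrow> thesis" "q = 0 \<Longrightarrow> thesis" "q = 1 \<Longrightarrow> thesis" "\<And>p. q = int p + 2 \<Longrightarrow> thesis"
    show thesis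
    proof (cases "2 \<le> q")
      case True
      then have "q = int (nat (q - 2)) + 2" by simp
      then show ?thesis by (rule *(4))
    qed (use * in linarith)
  qed
  then show ?thesis
  proof cases
    case (4 p)
    define A B C where "A = real (z choose p)" and "B = real (z choose Suc p)" and "C = real (z choose Suc (Suc p))"
    have AB: "(real p + 1) * B = (real z - real p) * A"
      using binomial_absorb_real[of p z] by (simp add: A_def B_def algebra_simps)
    have BC: "(real p + 2) * C = (real z - real p - 1) * B"
      using binomial_absorb_real[of "Suc p" z] by (simp add: C_def B_def algebra_simps)
    have n: "nat (int z + 1) = Suc z" "nat (2 + int z) = Suc (Suc z)" "nat (int p + 2) = Suc (Suc p)" by auto
    have "binomial_int (y + 1) q = A + 2 * B + C" "binomial_int y q = B + C" "binomial_int (y - 1) (q - 2) = A"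
      by (simp_all add: binomial_int_def y 4 n A_def B_def C_def)
    \<comment> \<open>An explicit certificate: the difference of the two sides is a combination of
      the relations \<open>AB\<close> and \<open>BC\<close> with linear multipliers.\<close>
    moreover have "(2 * real z + 2 - real p) * (2 * real z + 1 - real p) * (A + 2 * B + C)
      - ((2 * real z + 4) * (2 * real z + 3) * (B + C) + (real z + 1) * (real z + 2) * A)
      = (real p - 3 * real z - 3) * ((real p + 1) * B - (real z - real p) * A)
        + (real p - 4 * real z - 5) * ((real p + 2) * C - (real z - real p - 1) * B)"
      by (simp add: algebra_simps)
    then have "(2 * real z + 2 - real p) * (2 * real z + 1 - real p) * (A + 2 * B + C)
      = (2 * real z + 4) * (2 * real z + 3) * (B + C) + (real z + 1) * (real z + 2) * A"
      unfolding AB BC by simp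
    ultimately show ?thesis by (simp add: y 4 algebra_simps)
  qed (auto simp: y binomial_int_def nat_add_distrib algebra_simps)
qed

text \<open>The diagonal of the bidiagonal factor is the column weight evaluated at
  \<open>i = 2 * r + 2\<close>, so rows and columns are later governed by the same function
  \<open>fact_ratio\<close>.\<close>

lemma col_det_path_col_Suc:
  assumes "\<And>i. i \<in> set K \<Longrightarrow> 1 \<le> i"
  shows "col_det (map (\<lambda>i. path_col (int (Suc x)) (int i)) K) *
      (\<Prod>s<length K. (2 * real x + real (K ! s) + 1) * (2 * real x + real (K ! s) + 2))
    = (\<Prod>r<length K. (2 * real x + real (2 * r + 2) + 1) * (2 * real x + real (2 * r + 2) + 2)) *
      col_det (map (\<lambda>i. path_col (int x) (int i)) K)"
proof -
  let ?l = "\<lambda>r t. if t = r then (2 * real x + real (2 * r + 2) + 1) * (2 * real x + real (2 * r + 2) + 2)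
    else if Suc t = r then (real x + real r + 1) * (real x + real r + 2) else 0"
  have "(2 * real x + real (K ! s) + 1) * (2 * real x + real (K ! s) + 2) *
      path_col (int (Suc x)) (int (K ! s)) r
    = (\<Sum>t<length K. ?l r t * path_col (int x) (int (K ! s)) t)"
    if rs: "r < length K" "s < length K" for r s
  proof -
    define i where "i = K ! s"
    have i: "1 \<le> i" using assms rs by (simp add: i_def)
    have "(\<Sum>t<length K. ?l r t * path_col (int x) (int i) t)
        = (\<Sum>t\<in>{t. t = r \<or> Suc t = r}. ?l r t * path_col (int x) (int i) t)"
      by (rule sum.mono_neutral_right) (use rs in auto)
    also have "\<dots> = (2 * real x + real (2 * r + 2) + 1) * (2 * real x + real (2 * r + 2) + 2) * path_col (int x) (int i) r
        + (real x + real r + 1) * (real x + real r + 2) * binomial_int (int x + int r) (2 * int r - int i)"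
    proof (cases r)
      \<comment> \<open>Row 0 has no predecessor; the second term is zero here because
        \<open>1 <= i\<close> makes its lower argument negative.\<close>
      case 0
      then have "{t. t = r \<or> Suc t = r} = {0}" by auto
      then show ?thesis using 0 i by (simp add: binomial_int_eq_0)
    next
      case (Suc r')
      then have "{t. t = r \<or> Suc t = r} = {r, r'}" by auto
      then show ?thesis using Suc by (simp add: path_col_def algebra_simps)
    qed
    also have "\<dots> = (2 * real x + real i + 1) * (2 * real x + real i + 2) * path_col (int (Suc x)) (int i) r"
      using binomial_int_shift[of "int x + int r + 1" "2 * (int r + 1) - int i"]
      by (simp add: path_col_def algebra_simps)
    finally show ?thesis by (simp add: i_def)
  qed
  then show ?thesis
    using col_det_scale_transform[of "map (\<lambda>i. path_col (int x) (int i)) K"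
        "map (\<lambda>i. path_col (int (Suc x)) (int i)) K" ?l
        "\<lambda>s. (2 * real x + real (K ! s) + 1) * (2 * real x + real (K ! s) + 2)"]
    by simp
qed

text \<open>The product of the weights \<open>(2 * y + i + 1) * (2 * y + i + 2)\<close> over all
  \<open>y < x\<close>.\<close>

definition fact_ratio :: "nat \<Rightarrow> nat \<Rightarrow> real" where
  "fact_ratio x i = fact (2 * x + i) / fact i"

lemma fact_ratio_pos: "fact_ratio x i > 0"
  by (simp add: fact_ratio_def)

lemma fact_ratio_Suc:
  "fact_ratio (Suc x) i = fact_ratio x i * ((2 * real x + real i + 1) * (2 * real x + real i + 2))"
proof -
  have "fact (2 * Suc x + i) = (2 * real x + real i + 1) * (2 * real x + real i + 2) * fact (2 * x + i)"
    by (simp add: algebra_simps)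
  then show ?thesis by (simp add: fact_ratio_def)
qed

lemma col_det_path_col_eq:
  assumes "\<And>i. i \<in> set K \<Longrightarrow> 1 \<le> i"
  shows "col_det (map (\<lambda>i. path_col (int x) (int i)) K) * (\<Prod>s<length K. fact_ratio x (K ! s))
    = (\<Prod>r<length K. fact_ratio x (2 * r + 2)) * col_det (map (\<lambda>i. path_col 0 (int i)) K)"
proof (induction x)
  case 0
  show ?case by (simp add: fact_ratio_def)
next
  case (Suc x)
  let ?D = "\<lambda>x. col_det (map (\<lambda>i. path_col (int x) (int i)) K)"
  let ?u = "\<lambda>i. (2 * real x + real i + 1) * (2 * real x + real i + 2)"
  let ?n = "length K"
  have split: "(\<Prod>s<?n. fact_ratio (Suc x) (h s)) = (\<Prod>s<?n. fact_ratio x (h s)) * (\<Prod>s<?n. ?u (h s))" for h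
    by (simp only: fact_ratio_Suc prod.distrib)
  have "?D (Suc x) * (\<Prod>s<?n. fact_ratio (Suc x) (K ! s))
      = (?D (Suc x) * (\<Prod>s<?n. ?u (K ! s))) * (\<Prod>s<?n. fact_ratio x (K ! s))"
    unfolding split by (simp only: mult_ac)
  also have "\<dots> = (\<Prod>r<?n. ?u (2 * r + 2)) * (?D x * (\<Prod>s<?n. fact_ratio x (K ! s)))"
    by (subst col_det_path_col_Suc[of K x]) (auto simp only: assms mult.assoc)
  also have "\<dots> = (\<Prod>r<?n. fact_ratio (Suc x) (2 * r + 2)) * ?D 0"
    unfolding Suc.IH split by (simp only: mult_ac of_nat_0)
  finally show ?case by (simp only: of_nat_0)
qed

text \<open>The case \<open>x = 0\<close>, with \<open>N = a + k\<close> paths.\<close>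

definition gap_det :: "nat \<Rightarrow> nat \<Rightarrow> nat \<Rightarrow> real" where
  "gap_det N j k = col_det (map (\<lambda>i. path_col 0 (int i)) ([1..<j] @ [j + k..<N + k + 1]))"

lemma path_col_0_eq_0: "2 * (int r + 1) < i \<or> i \<le> int r \<Longrightarrow> path_col 0 i r = 0"
  unfolding path_col_def by (rule binomial_int_eq_0) auto

lemma col_det_path_col_0: "col_det (map (\<lambda>i. path_col 0 (int i)) [1..<Suc n]) = 1"
proof -
  let ?L = "map (\<lambda>i. path_col 0 (int i)) [1..<Suc n]"
  have "col_det ?L = (\<Prod>r<length ?L. (?L ! r) r)"
    by (rule col_det_upper_triangular) (auto simp del: upt_Suc intro: path_col_0_eq_0)
  also have "\<dots> = 1"
    by (intro prod.neutral ballI) (simp add: path_col_def binomial_int_def nat_add_distrib del: upt_Suc)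
  finally show ?thesis .
qed

lemma gap_det_no_gap:
  assumes "1 \<le> j" "j \<le> N + 1" shows "gap_det N j 0 = 1"
  using assms col_det_path_col_0[of N] upt_add_eq_append[of 1 j "Suc N - j"]
  by (simp add: gap_det_def del: upt_Suc)

lemma gap_det_empty:
  assumes "1 \<le> j" shows "gap_det (j - 1) j k = 1"
  using assms col_det_path_col_0[of "j - 1"] by (simp add: gap_det_def del: upt_Suc)

text \<open>A single column behind the gap keeps the matrix upper triangular and changes only the
  last diagonal entry.\<close>

lemma gap_det_single:
  assumes "1 \<le> j" "k \<le> j" shows "gap_det j j k = real (j choose k)"
proof -
  let ?L = "map (\<lambda>i. path_col 0 (int i)) ([1..<j] @ [j + k])"
  obtain m where m: "j = Suc m" using assms by (cases j) auto
  have "col_det ?L = (\<Prod>r<length ?L. (?L ! r) r)"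
    by (rule col_det_upper_triangular)
       (auto simp: m nth_append simp del: upt_Suc intro!: path_col_0_eq_0)
  also have "\<dots> = (\<Prod>r<m. (?L ! r) r) * (?L ! m) m" by (simp add: m del: upt_Suc)
  also have "(\<Prod>r<m. (?L ! r) r) = 1"
    by (intro prod.neutral ballI)
       (simp add: m nth_append path_col_def binomial_int_def nat_add_distrib del: upt_Suc)
  also have "(?L ! m) m = binomial_int (int j) (int (j - k))"
    using assms by (simp add: m nth_append path_col_def algebra_simps del: upt_Suc)
  also have "\<dots> = real (j choose k)"
    using assms binomial_symmetric[of k j] by (simp add: binomial_int_def del: of_nat_diff)
  finally show ?thesis by (simp add: gap_det_def)
qed

text \<open>The first \<open>j\<close> paths start in rows up to \<open>2 * j\<close>, while the
  ends behind the gap begin in row \<open>2 * j + 1\<close>; only \<open>j - 1\<close> ends are left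
  for them.\<close>

lemma gap_det_zero:
  assumes "1 \<le> j" "j \<le> N" shows "gap_det N j (j + 1) = 0"
  unfolding gap_det_def
proof (rule col_det_zero_block)
  let ?K = "[1..<j] @ [j + (j + 1)..<N + (j + 1) + 1]"
  show "j - 1 < length (map (\<lambda>i. path_col 0 (int i)) ?K)" using assms by simp
  fix r s assume rs: "r \<le> j - 1" "j - 1 \<le> s" "s < length (map (\<lambda>i. path_col 0 (int i)) ?K)"
  then have "?K ! s = j + (j + 1) + (s - (j - 1))" by (simp add: nth_append del: upt_Suc)
  then show "(map (\<lambda>i. path_col 0 (int i)) ?K ! s) r = 0"
    using rs assms by (subst nth_map) (auto intro!: path_col_0_eq_0)
qed

text \<open>All six determinants have \<open>N + 1\<close> columns; those containing
  \<open>unit_col N\<close> collapse to size \<open>N\<close>. Filling in column \<open>j\<close> or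
  leaving out column \<open>j + Suc k\<close> moves an end of the gap by one.\<close>

lemma gap_det_pluecker:
  assumes "1 \<le> j" "j \<le> N"
  shows "gap_det (Suc N) (j + 1) k * gap_det N j (Suc k + 1)
    - gap_det (Suc N) (j + 1) (Suc k) * gap_det N j (Suc k)
    + gap_det N (j + 1) (Suc k) * gap_det (Suc N) j (Suc k) = 0"
proof -
  define c where "c = (\<lambda>i. path_col 0 (int i))"
  define A where "A = map c [1..<j]"
  define B where "B = map c [j + Suc k + 1..<N + Suc k + 1]"
  define e where "e = unit_col N"
  let ?\<psi> = "\<lambda>u v. col_det (A @ u # B @ [v])"
  let ?j = "c j" and ?b = "c (j + Suc k)" and ?l = "c (N + Suc k + 1)"
  have len: "length A + length B + 1 = N" using assms unfolding A_def B_def length_map length_upt by linarith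
  have e: "?\<psi> u e = col_det (A @ u # B)" for u
    using col_det_append_unit_col[of "A @ u # B"] len by (simp add: e_def)
  have A': "map c [1..<j + 1] = A @ [?j]" using assms by (simp add: A_def)
  have B1: "map c [j + Suc k..<N + Suc k + 1] = ?b # B"
    using assms by (subst upt_conv_Cons) (auto simp: B_def)
  have "[j + Suc k + 1..<Suc (N + Suc k + 1)] = [j + Suc k + 1..<N + Suc k + 1] @ [N + Suc k + 1]"
    by (rule upt_Suc_append) (use assms in simp)
  then have B2: "map c [j + Suc k + 1..<N + Suc k + 1 + 1] = B @ [?l]"
    by (simp add: B_def del: upt_Suc)
  have B3: "map c [j + Suc k..<N + Suc k + 1 + 1] = ?b # B @ [?l]"
    using assms B2 by (subst upt_conv_Cons) auto
  \<comment> \<open>Moving a column past \<open>B\<close> costs the sign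
    \<open>(-1) ^ length B\<close>, here and in \<open>g2\<close>; the two signs cancel in the
    product.\<close>
  have g1: "gap_det (Suc N) (j + 1) k = (-1) ^ length B * ?\<psi> ?j ?b"
    using col_det_rotate[of "A @ [?j]" ?b B "[]"] A' B1
    by (simp add: gap_det_def c_def[symmetric] del: upt_Suc)
  have A1: "map c [Suc 0..<j] = A" by (simp add: A_def)
  have g2: "gap_det N j (Suc k + 1) = (-1) ^ length B * ?\<psi> ?l e"
    using col_det_rotate[of A ?l B "[]"] B2 unfolding e
    by (simp add: gap_det_def c_def[symmetric] A1 flip: power_mult_distrib mult.assoc del: upt_Suc)
  have g3: "gap_det (Suc N) (j + 1) (Suc k) = ?\<psi> ?j ?l"
    using A' B2 by (simp add: gap_det_def c_def[symmetric] del: upt_Suc)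
  have g4: "gap_det N j (Suc k) = ?\<psi> ?b e"
    using B1 unfolding e by (simp add: gap_det_def c_def[symmetric] A1 del: upt_Suc)
  have g5: "gap_det N (j + 1) (Suc k) = ?\<psi> ?j e"
    using A' unfolding e by (simp add: gap_det_def c_def[symmetric] B_def del: upt_Suc)
  have g6: "gap_det (Suc N) j (Suc k) = ?\<psi> ?b ?l"
    using B3 by (simp add: gap_det_def c_def[symmetric] A1 del: upt_Suc)
  have "s * p * (s * q) = p * q" if "s * s = 1" for s p q :: real
  proof -
    have "s * p * (s * q) = (s * s) * (p * q)" by (simp only: mult_ac)
    then show ?thesis using that by simp
  qed
  moreover have "(-1) ^ length B * (-1) ^ length B = (1 :: real)"
    by (simp flip: power_mult_distrib)
  ultimately have "gap_det (Suc N) (j + 1) k * gap_det N j (Suc k + 1) = ?\<psi> ?j ?b * ?\<psi> ?l e"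
    unfolding g1 g2 by blast
  then show ?thesis
    using col_det_pluecker[of A ?j B ?b ?l e] unfolding g3 g4 g5 g6 by simp
qed

section \<open>Product formula for the case \<open>x = 0\<close>\<close>

definition gap_factor :: "nat \<Rightarrow> nat \<Rightarrow> nat \<Rightarrow> real" where
  "gap_factor J k n = fact (k + J + n) * fact (2 * k + J + 2 * n) * fact n /
     (fact (k + n) * fact (2 * k + J + n) * fact (J + 2 * n))"

text \<open>The last product of the theorem, with \<open>J = j - k\<close>; \<open>t\<close> is the
  number of columns behind the gap.\<close>

definition gap_prod :: "nat \<Rightarrow> nat \<Rightarrow> nat \<Rightarrow> real" where
  "gap_prod t J k = (\<Prod>n<t. gap_factor J k n)"

text \<open>The shift keeps \<open>J + n\<close> fixed, so just four of the six factorials change,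
  each by one factor.\<close>

lemma gap_factor_shift:
  "gap_factor J k (Suc t) * ((real k + real t + 1) * (real J + 2 * real t + 2))
    = gap_factor (Suc J) k t * ((2 * real k + real J + 2 * real t + 2) * (real t + 1))"
proof -
  have f: "fact (2 * k + J + 2 * Suc t) = (2 * real k + real J + 2 * real t + 2) * fact (2 * k + Suc J + 2 * t)"
    "fact (Suc t) = (real t + 1) * fact t"
    "fact (k + Suc t) = (real k + real t + 1) * fact (k + t)"
    "fact (J + 2 * Suc t) = (real J + 2 * real t + 2) * fact (Suc J + 2 * t)"
    "k + J + Suc t = k + Suc J + t" "2 * k + J + Suc t = 2 * k + Suc J + t"
    by (simp_all add: algebra_simps)
  have nz: "real k + real t + 1 \<noteq> 0" "real J + 2 * real t + 2 \<noteq> 0" by linarith+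
  show ?thesis
    unfolding gap_factor_def f using nz by (simp add: divide_simps del: fact_Suc)
qed

text \<open>The three kinds of factorials that involve both \<open>J\<close> and \<open>k\<close>
  agree on the two sides; only those of \<open>k + n\<close> and \<open>J + 2 * n\<close> leave a
  quotient.\<close>

lemma gap_factor_quadratic:
  "gap_factor (J + 3) k n * gap_factor J (k + 2) n * ((real k + real n + 2) * (real J + 2 * real n + 3))
    = gap_factor (J + 1) (k + 1) n * gap_factor (J + 2) (k + 1) n * ((real k + real n + 1) * (real J + 2 * real n + 1))"
proof -
  have f: "fact (k + 2 + n) = (real k + real n + 2) * fact (k + 1 + n)"
    "fact (k + 1 + n) = (real k + real n + 1) * fact (k + n)"
    "fact (J + 3 + 2 * n) = (real J + 2 * real n + 3) * fact (J + 2 + 2 * n)"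
    "fact (J + 1 + 2 * n) = (real J + 2 * real n + 1) * fact (J + 2 * n)"
    by (simp_all add: numeral_eq_Suc algebra_simps)
  have e: "k + (J + 3) + n = k + J + n + 3" "2 * k + (J + 3) + 2 * n = 2 * k + J + 2 * n + 3"
    "2 * k + (J + 3) + n = 2 * k + J + n + 3"
    "k + 2 + J + n = k + J + n + 2" "2 * (k + 2) + J + 2 * n = 2 * k + J + 2 * n + 4"
    "2 * (k + 2) + J + n = 2 * k + J + n + 4"
    "k + 1 + (J + 1) + n = k + J + n + 2" "2 * (k + 1) + (J + 1) + 2 * n = 2 * k + J + 2 * n + 3"
    "2 * (k + 1) + (J + 1) + n = 2 * k + J + n + 3"
    "k + 1 + (J + 2) + n = k + J + n + 3" "2 * (k + 1) + (J + 2) + 2 * n = 2 * k + J + 2 * n + 4"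
    "2 * (k + 1) + (J + 2) + n = 2 * k + J + n + 4"
    by simp_all
  have nz: "real k + real n + 1 \<noteq> 0" "real k + real n + 2 \<noteq> 0"
    "real J + 2 * real n + 3 \<noteq> 0" "real J + 2 * real n + 1 \<noteq> 0" by linarith+
  show ?thesis
    unfolding gap_factor_def e f using nz by (simp add: divide_simps del: fact_Suc)
qed

text \<open>The two quadratic expressions of \<open>gap_factor_shift\<close> differ by exactly
  \<open>k * J\<close>. For \<open>J = 0\<close> this gives 0, in accordance with
  \<open>gap_det_zero\<close>.\<close>

lemma gap_factor_diff:
  "gap_factor (Suc J) k t - gap_factor J k (Suc t)
    = gap_factor (Suc J) k t * (real k * real J) / ((real k + real t + 1) * (real J + 2 * real t + 2))"
proof -
  have nz: "(real k + real t + 1) * (real J + 2 * real t + 2) \<noteq> 0"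
    by (simp add: add_nonneg_eq_0_iff)
  have "gap_factor J k (Suc t) = gap_factor (Suc J) k t * ((2 * real k + real J + 2 * real t + 2) * (real t + 1))
      / ((real k + real t + 1) * (real J + 2 * real t + 2))"
    using gap_factor_shift[of J k t] nz by (simp add: eq_divide_eq)
  also have "gap_factor (Suc J) k t - \<dots> = gap_factor (Suc J) k t * (real k * real J) / ((real k + real t + 1) * (real J + 2 * real t + 2))"
    using nz by (simp add: field_simps)
  finally show ?thesis .
qed

text \<open>Evaluates the first term of the Pluecker relation. In the induction the denominators of
  \<open>w t\<close> cancel against the numerators of \<open>quot\<close> at \<open>Suc t\<close>,
  which turns \<open>w t\<close> into \<open>w (Suc t)\<close>. The arguments \<open>J\<close> and
  \<open>k\<close> are one less than in the relation, to stay clear of subtraction.\<close>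

lemma gap_prod_quadratic:
  "gap_prod (Suc t) (J + 3) k * gap_prod (Suc t) J (k + 2)
    = gap_prod t (J + 2) (k + 1) * gap_prod (Suc t) (J + 1) (k + 1) *
      (gap_factor (J + 2) (k + 1) t - gap_factor (J + 1) (k + 1) (Suc t))"
proof -
  define w where "w t = gap_factor (J + 2) (k + 1) t * ((real k + 1) * (real J + 1)) / ((real k + real t + 2) * (real J + 2 * real t + 3))" for t
  have w: "gap_factor (J + 2) (k + 1) t - gap_factor (J + 1) (k + 1) (Suc t) = w t" for t
    using gap_factor_diff[of "J + 1" "k + 1" t] by (simp add: w_def add_ac numeral_eq_Suc)
  have nz: "real k + real t + 2 \<noteq> 0" "real J + 2 * real t + 3 \<noteq> 0" for t by linarith+
  have quot: "gap_factor (J + 3) k n * gap_factor J (k + 2) n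
    = gap_factor (J + 1) (k + 1) n * gap_factor (J + 2) (k + 1) n * ((real k + real n + 1) * (real J + 2 * real n + 1))
      / ((real k + real n + 2) * (real J + 2 * real n + 3))" for n
    using gap_factor_quadratic[of J k n] nz[of n] by (simp add: eq_divide_eq)
  have "gap_prod (Suc t) (J + 3) k * gap_prod (Suc t) J (k + 2)
    = gap_prod t (J + 2) (k + 1) * gap_prod (Suc t) (J + 1) (k + 1) * w t"
  proof (induction t)
    case 0
    show ?case using quot[of 0] by (simp add: gap_prod_def w_def)
  next
    case (Suc t)
    have quot_step: "w t * (gap_factor (J + 3) k (Suc t) * gap_factor J (k + 2) (Suc t))
        = gap_factor (J + 2) (k + 1) t * gap_factor (J + 1) (k + 1) (Suc t) * w (Suc t)"
    proof -
      have cancel: "(F * c / (a * b)) * (G * H * (a * b) / e) = F * G * (H * c / e)"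
        if "a \<noteq> 0" "b \<noteq> 0" for F G H a b c e :: real
        using that by simp
      have "real k + real (Suc t) + 1 = real k + real t + 2" "real J + 2 * real (Suc t) + 1 = real J + 2 * real t + 3"
        by simp_all
      then show ?thesis unfolding quot w_def by (simp only: cancel[OF nz])
    qed
    have step: "x * w t * (gap_factor (J + 3) k (Suc t) * gap_factor J (k + 2) (Suc t))
        = x * (gap_factor (J + 2) (k + 1) t * gap_factor (J + 1) (k + 1) (Suc t) * w (Suc t))" for x
      by (simp only: mult.assoc[of x] quot_step)
    have gap_prod_Suc: "gap_prod (Suc t) J k = gap_prod t J k * gap_factor J k t" for t J k
      by (simp add: gap_prod_def)
    have "gap_prod (Suc (Suc t)) (J + 3) k * gap_prod (Suc (Suc t)) J (k + 2)
       = (gap_prod (Suc t) (J + 3) k * gap_prod (Suc t) J (k + 2)) * (gap_factor (J + 3) k (Suc t) * gap_factor J (k + 2) (Suc t))"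
      by (simp only: gap_prod_Suc[of "Suc t"] mult_ac)
    also have "\<dots> = gap_prod t (J + 2) (k + 1) * gap_prod (Suc t) (J + 1) (k + 1)
        * (gap_factor (J + 2) (k + 1) t * gap_factor (J + 1) (k + 1) (Suc t) * w (Suc t))"
      unfolding Suc.IH by (rule step)
    also have "\<dots> = gap_prod (Suc t) (J + 2) (k + 1) * gap_prod (Suc (Suc t)) (J + 1) (k + 1) * w (Suc t)"
      by (simp only: gap_prod_Suc[of t "J + 2"] gap_prod_Suc[of "Suc t"] mult_ac)
    finally show ?case .
  qed
  then show ?thesis by (simp only: w)
qed

lemma gap_prod_pos: "gap_prod t J k > 0"
  unfolding gap_prod_def gap_factor_def by (intro prod_pos) simp

text \<open>In the relation one determinant has \<open>t + 2\<close> columns behind the gap and the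
  other five have \<open>t\<close> or \<open>t + 1\<close>, hence the two-step induction. The factor
  of the unknown one is positive and can be cancelled.\<close>

lemma gap_det_eq_gap_prod:
  assumes "1 \<le> k + J"
  shows "gap_det (t + (k + J) - 1) (k + J) k = gap_prod t J k"
  using assms
proof (induction t arbitrary: J k rule: induct_nat_012)
  case 0
  then show ?case using gap_det_empty[of "k + J" k] by (simp add: gap_prod_def)
next
  case 1
  have "real ((k + J) choose k) = fact (k + J) / (fact k * fact J)"
    using binomial_fact[of k "k + J", where 'a = real] by simp
  then show ?case using 1 gap_det_single[of "k + J" k] by (simp add: gap_prod_def gap_factor_def)
next
  case (ge2 t)
  show ?case
  proof (cases k)
    case 0
    then have "gap_prod (Suc (Suc t)) J k = 1" by (simp add: gap_prod_def gap_factor_def mult.commute)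
    then show ?thesis using 0 ge2.prems gap_det_no_gap by simp
  next
    case (Suc k')
    let ?j = "k + J"
    have "gap_det (Suc (t + ?j)) (?j + 1) k' * gap_det (t + ?j) ?j (k + 1)
      - gap_det (Suc (t + ?j)) (?j + 1) k * gap_det (t + ?j) ?j k
      + gap_det (t + ?j) (?j + 1) k * gap_det (Suc (t + ?j)) ?j k = 0"
      using gap_det_pluecker[of ?j "t + ?j" k'] ge2.prems Suc by simp
    moreover have "gap_det (Suc (t + ?j)) (?j + 1) k' = gap_prod (Suc t) (J + 2) k'"
      using ge2.IH(2)[of k' "J + 2"] Suc by (simp add: algebra_simps)
    moreover have "gap_det (Suc (t + ?j)) (?j + 1) k = gap_prod (Suc t) (J + 1) k"
      using ge2.IH(2)[of k "J + 1"] by (simp add: algebra_simps)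
    moreover have "gap_det (t + ?j) ?j k = gap_prod (Suc t) J k"
      using ge2.IH(2)[of k J] ge2.prems by (simp add: algebra_simps)
    moreover have "gap_det (t + ?j) (?j + 1) k = gap_prod t (J + 1) k"
      using ge2.IH(1)[of k "J + 1"] by (simp add: algebra_simps)
    moreover have "gap_prod (Suc t) (J + 2) k' * gap_det (t + ?j) ?j (k + 1)
        = gap_prod t (J + 1) k * gap_prod (Suc t) J k *
          (gap_factor (J + 1) k t - gap_factor J k (Suc t))"
    proof (cases J)
      \<comment> \<open>The gap \<open>k + 1\<close> is now longer than \<open>j = k\<close>,
        outside the range of the induction hypothesis; both sides vanish.\<close>
      case 0
      then show ?thesis
        using gap_det_zero[of k "t + k"] gap_factor_diff[of 0 k t] Suc by simp
    next
      case (Suc J')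
      then show ?thesis
        using ge2.IH(2)[of "k + 1" J'] gap_prod_quadratic[of t J' k'] \<open>k = Suc k'\<close>
        by (simp add: algebra_simps numeral_eq_Suc)
    qed
    ultimately have "gap_prod t (J + 1) k * gap_det (Suc (t + ?j)) ?j k
      = gap_prod (Suc t) (J + 1) k * gap_prod (Suc t) J k
        - gap_prod t (J + 1) k * gap_prod (Suc t) J k * (gap_factor (J + 1) k t - gap_factor J k (Suc t))"
      by simp
    also have "\<dots> = gap_prod t (J + 1) k * gap_prod (Suc (Suc t)) J k"
      by (simp add: gap_prod_def algebra_simps)
    finally have "gap_det (Suc (t + ?j)) ?j k = gap_prod (Suc (Suc t)) J k"
      using gap_prod_pos[of t "J + 1" k] by simp
    then show ?thesis by simp
  qed
qed

section \<open>Comparison with the product formula\<close>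

lemma fact_ratio_Suc_right:
  "fact_ratio x (Suc m) = fact_ratio x m * ((2 * real x + real (Suc m)) / real (Suc m))"
  by (simp add: fact_ratio_def mult_ac add_ac)

lemma prod_fact_ratio_Suc:
  "(\<Prod>n=1..a. (2 * real x + real (c + n)) / real (c + n)) = fact_ratio x (c + a) / fact_ratio x c"
proof (induction a)
  case 0
  then show ?case using fact_ratio_pos[of x c] by simp
next
  case (Suc a)
  then show ?case using fact_ratio_Suc_right[of x "c + a"] by (simp add: mult_ac add_ac)
qed

text \<open>The range \<open>a + 1\<close> to \<open>2 * a\<close> consists of the sums
  \<open>n + m\<close> for \<open>m = a\<close> and \<open>n\<close> from 1 to
  \<open>m\<close>.\<close>

lemma prod_split_parity:
  fixes u :: "nat \<Rightarrow> real"
  shows "(\<Prod>s=a+1..2*a. u s) = (\<Prod>t\<in>{t. a < 2 * t \<and> t \<le> a}. u (2 * t)) * (\<Prod>t\<in>{t. a \<le> 2 * t \<and> t < a}. u (2 * t + 1))"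
proof -
  have fin: "finite {t. a < 2 * t \<and> t \<le> a}" "finite {t. a \<le> 2 * t \<and> t < a}"
    by (auto intro: finite_subset[of _ "{..a}"])
  have "{a+1..2*a} = (\<lambda>t. 2 * t) ` {t. a < 2 * t \<and> t \<le> a} \<union> (\<lambda>t. 2 * t + 1) ` {t. a \<le> 2 * t \<and> t < a}"
  proof (intro equalityI subsetI)
    fix s assume s: "s \<in> {a+1..2*a}"
    show "s \<in> (\<lambda>t. 2 * t) ` {t. a < 2 * t \<and> t \<le> a} \<union> (\<lambda>t. 2 * t + 1) ` {t. a \<le> 2 * t \<and> t < a}"
      using s by (cases "even s") (auto elim!: evenE oddE)
  qed auto
  moreover have "(\<lambda>t. 2 * t) ` {t. a < 2 * t \<and> t \<le> a} \<inter> (\<lambda>t. 2 * t + 1) ` {t. a \<le> 2 * t \<and> t < a} = {}"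
    by (auto, presburger)
  ultimately show ?thesis
    using fin by (simp add: prod.union_disjoint prod.reindex inj_on_def)
qed

lemma f_eq_min:
  assumes "1 \<le> n" "n \<le> a" shows "f a n = real (min n (a + 1 - n))"
  using assms by (auto simp: f_def min_def field_simps of_nat_diff)

lemma prod_powr_f:
  fixes u :: "nat \<Rightarrow> real"
  assumes "\<And>n. 1 \<le> n \<Longrightarrow> u n > 0"
  shows "(\<Prod>n=1..a. u n powr f a n) = (\<Prod>n=1..a. u n ^ min n (a + 1 - n))"
  by (intro prod.cong refl) (simp add: f_eq_min powr_realpow assms)

text \<open>The exponent grows by one exactly in the upper half of the range.\<close>

lemma prod_min_Suc:
  fixes u :: "nat \<Rightarrow> real"
  shows "(\<Prod>n=1..Suc a. u n ^ min n (Suc a + 1 - n))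
    = (\<Prod>n=1..a. u n ^ min n (a + 1 - n)) * (\<Prod>n\<in>{n. Suc a < 2 * n \<and> n \<le> Suc a}. u n)"
proof -
  have "(\<Prod>n=1..Suc a. u n ^ min n (Suc a + 1 - n))
    = (\<Prod>n=1..Suc a. u n ^ min n (a + 1 - n) * (if Suc a < 2 * n then u n else 1))"
  proof (intro prod.cong refl)
    fix n assume n: "n \<in> {1..Suc a}"
    have "min n (Suc a + 1 - n) = min n (a + 1 - n) + (if Suc a < 2 * n then 1 else 0)"
      using n by auto
    then show "u n ^ min n (Suc a + 1 - n) = u n ^ min n (a + 1 - n) * (if Suc a < 2 * n then u n else 1)"
      by (simp add: power_add)
  qed
  also have "\<dots> = (\<Prod>n=1..Suc a. u n ^ min n (a + 1 - n)) * (\<Prod>n=1..Suc a. if Suc a < 2 * n then u n else 1)"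
    by (rule prod.distrib)
  also have "(\<Prod>n=1..Suc a. if Suc a < 2 * n then u n else 1) = (\<Prod>n\<in>{n \<in> {1..Suc a}. Suc a < 2 * n}. u n)"
    by (rule prod.inter_filter[symmetric]) simp
  also have "{n \<in> {1..Suc a}. Suc a < 2 * n} = {n. Suc a < 2 * n \<and> n \<le> Suc a}" by auto
  finally show ?thesis by simp
qed

text \<open>
  Grouped by \<open>s = n + m\<close>, the product of \<open>u (n + m)\<close> over \<open>1 \<le> n \<le> m \<le> a\<close> has the factor \<open>u s\<close>
  exactly \<open>f a t\<close> times if \<open>s = 2 * t\<close> and \<open>f (a - 1) t\<close> times if \<open>s = 2 * t + 1\<close>.
\<close>

lemma prod_powr_f_eq_fact_ratio:
  "(\<Prod>n=1..a. (real (x + k + n) / real (k + n)) powr f a n) *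
   (\<Prod>n=1..a-1. (real (2*x + 2*k + 2*n + 1) / real (2*k + 2*n + 1)) powr f (a-1) n)
   = (\<Prod>m=1..a. fact_ratio x (2 * k + 2 * m) / fact_ratio x (2 * k + m))"
proof -
  define u where "u = (\<lambda>s. (2 * real x + real (2 * k + s)) / real (2 * k + s))"
  define e where "e = (\<lambda>n. real (x + k + n) / real (k + n))"
  define d where "d = (\<lambda>n. real (2*x + 2*k + 2*n + 1) / real (2*k + 2*n + 1))"
  have e: "e n = u (2 * n)" if "1 \<le> n" for n
    using that by (simp add: e_def u_def field_simps)
  have d: "d n = u (2 * n + 1)" for n
    by (simp add: d_def u_def algebra_simps)
  have "(\<Prod>n=1..a. e n powr f a n) = (\<Prod>n=1..a. u (2 * n) powr f a n)"
    by (intro prod.cong refl) (simp add: e)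
  then have pow_e: "(\<Prod>n=1..a. e n powr f a n) = (\<Prod>n=1..a. u (2 * n) ^ min n (a + 1 - n))"
    by (simp only:) (intro prod_powr_f, simp add: u_def)
  have pow_d: "(\<Prod>n=1..a. d n powr f a n) = (\<Prod>n=1..a. u (2 * n + 1) ^ min n (a + 1 - n))" for a
    unfolding d by (intro prod_powr_f) (simp add: u_def)
  have "(\<Prod>n=1..a. u (2 * n) ^ min n (a + 1 - n)) * (\<Prod>n=1..a-1. u (2 * n + 1) ^ min n (a - 1 + 1 - n))
      = (\<Prod>m=1..a. \<Prod>s=m+1..2*m. u s)"
  proof (induction a)
    case (Suc a)
    have "(\<Prod>n=1..a. u (2 * n + 1) ^ min n (a + 1 - n))
        = (\<Prod>n=1..a-1. u (2 * n + 1) ^ min n (a - 1 + 1 - n)) * (\<Prod>n\<in>{n. Suc a \<le> 2 * n \<and> n < Suc a}. u (2 * n + 1))"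
    proof (cases a)
      case 0
      then have empty: "{n. Suc a \<le> 2 * n \<and> n < Suc a} = {}" by auto
      show ?thesis unfolding empty using 0 by simp
    next
      case (Suc b)
      then have "{n. Suc a \<le> 2 * n \<and> n < Suc a} = {n. Suc b < 2 * n \<and> n \<le> Suc b}" by auto
      then show ?thesis using Suc prod_min_Suc[of "\<lambda>n. u (2 * n + 1)" b] by simp
    qed
    then show ?case
      using Suc prod_min_Suc[of "\<lambda>n. u (2 * n)" a] prod_split_parity[of u "Suc a"]
      by (simp only: diff_Suc_1 Suc_eq_plus1[symmetric] prod.atLeast_Suc_atMost_Suc_shift) (simp add: mult_ac)
  qed simp
  moreover have "(\<Prod>s=m+1..2*m. u s) = fact_ratio x (2 * k + 2 * m) / fact_ratio x (2 * k + m)" for m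
  proof -
    have "(\<Prod>s=m+1..2*m. u s) = (\<Prod>n=1..m. u (n + m))"
      using prod.shift_bounds_cl_nat_ivl[of u 1 m m] by (simp add: mult_2)
    also have "\<dots> = fact_ratio x (2 * k + m + m) / fact_ratio x (2 * k + m)"
      unfolding prod_fact_ratio_Suc[symmetric] by (simp add: u_def add_ac)
    finally show ?thesis by (simp add: add_ac mult_2)
  qed
  ultimately show ?thesis
    unfolding pow_e[unfolded e_def] pow_d[of "a - 1", unfolded d_def] by simp
qed

text \<open>Row \<open>m\<close> of the triangle telescopes to indices \<open>2 * m - 1\<close> over
  \<open>m - 1\<close>. The single factor for \<open>m\<close> is \<open>(x + m) / m\<close> times
  \<open>m / (2 * x + m)\<close>, which raises both indices by one.\<close>

lemma prod_triangle_eq_fact_ratio: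
  "(\<Prod>n=1..b. real (x + n) / real (2*x + n)) *
   (\<Prod>(n, m)\<in>{(n, m). 1 \<le> n \<and> n \<le> m \<and> m \<le> b}. real (2*x + n + m - 1) / real (n + m - 1))
   = (\<Prod>m=1..b. fact_ratio x (2 * m) / fact_ratio x m)"
proof -
  have "(\<Prod>(n, m)\<in>{(n, m). 1 \<le> n \<and> n \<le> m \<and> m \<le> b}. real (2*x + n + m - 1) / real (n + m - 1))
    = (\<Prod>(m, n)\<in>(SIGMA m:{1..b}. {1..m}). real (2*x + n + m - 1) / real (n + m - 1))"
    by (rule prod.reindex_bij_witness[where i = "\<lambda>(m, n). (n, m)" and j = "\<lambda>(n, m). (m, n)"]) auto
  also have "\<dots> = (\<Prod>m=1..b. \<Prod>n=1..m. real (2*x + n + m - 1) / real (n + m - 1))"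
    by (subst prod.Sigma) auto
  finally have triangle: "(\<Prod>(n, m)\<in>{(n, m). 1 \<le> n \<and> n \<le> m \<and> m \<le> b}. real (2*x + n + m - 1) / real (n + m - 1))
    = (\<Prod>m=1..b. \<Prod>n=1..m. real (2*x + n + m - 1) / real (n + m - 1))" .
  have "(\<Prod>n=1..b. real (x + n) / real (2*x + n)) *
   (\<Prod>(n, m)\<in>{(n, m). 1 \<le> n \<and> n \<le> m \<and> m \<le> b}. real (2*x + n + m - 1) / real (n + m - 1))
   = (\<Prod>m=1..b. real (x + m) / real (2*x + m) * (\<Prod>n=1..m. real (2*x + n + m - 1) / real (n + m - 1)))"
    unfolding triangle by (rule prod.distrib[symmetric])
  also have "\<dots> = (\<Prod>m=1..b. fact_ratio x (2 * m) / fact_ratio x m)"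
  proof (rule prod.cong[OF refl])
    fix m assume "m \<in> {1..b}"
    then obtain p where m: "m = Suc p" by (cases m) auto
    have "(\<Prod>n=1..m. real (2*x + n + m - 1) / real (n + m - 1)) = (\<Prod>n=1..m. (2 * real x + real (p + n)) / real (p + n))"
      by (intro prod.cong refl) (simp add: m add_ac)
    also have "\<dots> = fact_ratio x (p + m) / fact_ratio x p" by (rule prod_fact_ratio_Suc)
    finally have row: "(\<Prod>n=1..m. real (2*x + n + m - 1) / real (n + m - 1)) = fact_ratio x (p + m) / fact_ratio x p" .
    have "2 * m = Suc (p + m)" by (simp add: m)
    then have top: "fact_ratio x (2 * m) = fact_ratio x (p + m) * ((2 * real x + real (2 * m)) / real (2 * m))"
      by (metis fact_ratio_Suc_right)
    have "(2 * real x + real (2 * m)) / real (2 * m) = (real x + real m) / real m"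
      by (simp add: m field_simps)
    then show "real (x + m) / real (2*x + m) * (\<Prod>n=1..m. real (2*x + n + m - 1) / real (n + m - 1))
      = fact_ratio x (2 * m) / fact_ratio x m"
      unfolding row top using fact_ratio_Suc_right[of x p]
      by (simp add: m[symmetric] del: of_nat_Suc) (simp add: m mult_ac)
  qed
  finally show ?thesis .
qed

lemma prod_shift_fact:
  "(\<Prod>m=a+1..a+l. real (c + m) / real m) = fact (c + a + l) * fact a / (fact (c + a) * fact (a + l))"
proof (induction l)
  case (Suc l)
  have "fact (c + a + Suc l) = real (c + (a + Suc l)) * fact (c + a + l)"
    "fact (a + Suc l) = real (a + Suc l) * fact (a + l)"
    by (simp_all add: add_ac)
  moreover have "(\<Prod>m=a+1..a+Suc l. real (c + m) / real m)
      = (\<Prod>m=a+1..a+l. real (c + m) / real m) * (real (c + (a + Suc l)) / real (a + Suc l))"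
    by (simp add: prod.nat_ivl_Suc')
  ultimately show ?case unfolding Suc.IH by (simp add: mult_ac del: of_nat_add of_nat_Suc fact_Suc)
qed simp

lemma gap_factor_eq_prod:
  "(\<Prod>m=1..J. real (k + Suc n + m - 1) / real (Suc n + m - 1)) *
   (\<Prod>m=J+1..J+n. real (2*k + Suc n + m - 1) / real (Suc n + m - 1)) = gap_factor J k n"
proof -
  have "(\<Prod>m=1..J. real (k + Suc n + m - 1) / real (Suc n + m - 1)) = (\<Prod>m=n+1..n+J. real (k + m) / real m)"
    using prod.shift_bounds_cl_nat_ivl[of "\<lambda>m. real (k + m) / real m" 1 n J] by (simp add: add_ac)
  also have "\<dots> = fact (k + n + J) * fact n / (fact (k + n) * fact (n + J))" by (rule prod_shift_fact)
  finally have 1: "(\<Prod>m=1..J. real (k + Suc n + m - 1) / real (Suc n + m - 1))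
    = fact (k + n + J) * fact n / (fact (k + n) * fact (n + J))" .
  have "(\<Prod>m=J+1..J+n. real (2*k + Suc n + m - 1) / real (Suc n + m - 1))
    = (\<Prod>m=J+n+1..J+n+n. real (2*k + m) / real m)"
    using prod.shift_bounds_cl_nat_ivl[of "\<lambda>m. real (2*k + m) / real m" "J + 1" n "J + n"] by (simp add: add_ac)
  also have "\<dots> = fact (2*k + (J + n) + n) * fact (J + n) / (fact (2*k + (J + n)) * fact (J + n + n))"
    by (rule prod_shift_fact)
  finally have 2: "(\<Prod>m=J+1..J+n. real (2*k + Suc n + m - 1) / real (Suc n + m - 1))
    = fact (2*k + (J + n) + n) * fact (J + n) / (fact (2*k + (J + n)) * fact (J + n + n))" .
  have e: "k + n + J = k + J + n" "n + J = J + n" "2*k + (J + n) + n = 2*k + J + 2*n"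
    "2*k + (J + n) = 2*k + J + n" "J + n + n = J + 2*n"
    by simp_all
  show ?thesis unfolding 1 2 gap_factor_def e by (simp add: mult_ac add_ac)
qed

text \<open>The row weight at \<open>2 * m\<close> is paired with the weight of the
  \<open>m\<close>-th column, whose index is \<open>m\<close> before the gap and
  \<open>k + m\<close> from \<open>m = j\<close> on. Shifted by \<open>k\<close>, the second group
  is the tail from \<open>j - k\<close> to \<open>a\<close> of the first product.\<close>

lemma col_det_gap_eq:
  assumes "max 1 k \<le> j" "j \<le> a + k + 1"
  shows "col_det (map (\<lambda>i. path_col (int x) (int i)) ([1..<j] @ [j + k..<a + 2 * k + 1]))
    = (\<Prod>m=1..a. fact_ratio x (2 * k + 2 * m) / fact_ratio x (2 * k + m))
      / (\<Prod>m=1..j-k-1. fact_ratio x (2 * k + 2 * m) / fact_ratio x (2 * k + m))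
      * (\<Prod>m=1..j-1. fact_ratio x (2 * m) / fact_ratio x m)
      * gap_prod (a + k + 1 - j) (j - k) k"
proof -
  let ?r = "fact_ratio x"
  let ?K = "[1..<j] @ [j + k..<a + 2 * k + 1]"
  have r: "?r i \<noteq> 0" for i using fact_ratio_pos[of x i] by simp
  have jk: "1 \<le> j" "k \<le> j" using assms by auto
  have len: "length ?K = a + k" using assms by auto
  have "(\<Prod>s<length K. ?r (K ! s)) = prod_list (map ?r K)" for K
    by (simp add: prod.list_conv_set_nth lessThan_atLeast0)
  then have "(\<Prod>s<length ?K. ?r (?K ! s)) = prod_list (map ?r ?K)" .
  also have "\<dots> = (\<Prod>i\<in>{1..<j}. ?r i) * (\<Prod>i\<in>{j + k..<a + 2 * k + 1}. ?r i)"
    by (simp add: prod.distinct_set_conv_list[symmetric] del: upt_Suc)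
  also have "{1..<j} = {1..j-1}" using jk by auto
  also have "(\<Prod>i\<in>{j + k..<a + 2 * k + 1}. ?r i) = (\<Prod>m\<in>{j..<a + k + 1}. ?r (k + m))"
    using prod.shift_bounds_nat_ivl[of ?r j k "a + k + 1"] by (simp add: add_ac mult_2)
  finally have P1: "(\<Prod>s<length ?K. ?r (?K ! s)) = (\<Prod>i=1..j-1. ?r i) * (\<Prod>m\<in>{j..<a + k + 1}. ?r (k + m))" .
  have "(\<Prod>s<length ?K. ?r (2 * s + 2)) = (\<Prod>m=1..<a + k + 1. ?r (2 * m))"
    unfolding len using prod.shift_bounds_nat_ivl[of "\<lambda>m. ?r (2 * m)" 0 1 "a + k"]
    by (simp add: lessThan_atLeast0)
  also have "{1..<a + k + 1} = {1..j-1} \<union> {j..<a + k + 1}" using jk assms by auto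
  also have "(\<Prod>m\<in>{1..j-1} \<union> {j..<a + k + 1}. ?r (2 * m))
      = (\<Prod>m=1..j-1. ?r (2 * m)) * (\<Prod>m\<in>{j..<a + k + 1}. ?r (2 * m))"
    using jk by (intro prod.union_disjoint) auto
  finally have P2: "(\<Prod>s<length ?K. ?r (2 * s + 2))
      = (\<Prod>m=1..j-1. ?r (2 * m)) * (\<Prod>m\<in>{j..<a + k + 1}. ?r (2 * m))" .
  let ?g = "\<lambda>m. ?r (2 * k + 2 * m) / ?r (2 * k + m)"
  have g: "?g m \<noteq> 0" for m using r by simp
  have "(\<Prod>m=1..a. ?g m) = (\<Prod>m=1..j-k-1. ?g m) * (\<Prod>m\<in>{j-k..<a + 1}. ?g m)"
  proof (cases "j = k")
    \<comment> \<open>The tail then starts at \<open>m = 0\<close>, whose factor is 1.\<close>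
    case True
    have "{0..<a + 1} = insert 0 {1..a}" by auto
    then show ?thesis using True r[of "2 * k"] by simp
  next
    case False
    then have "{1..a} = {1..j-k-1} \<union> {j-k..<a + 1}" using jk assms by auto
    moreover have "(\<Prod>m\<in>{1..j-k-1} \<union> {j-k..<a + 1}. ?g m) = (\<Prod>m=1..j-k-1. ?g m) * (\<Prod>m\<in>{j-k..<a + 1}. ?g m)"
      by (intro prod.union_disjoint) (use False jk in auto)
    ultimately show ?thesis by simp
  qed
  also have "(\<Prod>m\<in>{j-k..<a + 1}. ?g m) = (\<Prod>m\<in>{j..<a + k + 1}. ?r (2 * m) / ?r (k + m))"
  proof -
    have shift: "2 * (i + k) = 2 * k + 2 * i" "k + (i + k) = 2 * k + i" "j - k + k = j" "a + 1 + k = a + k + 1" for i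
      using jk by simp_all
    show ?thesis
      using prod.shift_bounds_nat_ivl[of "\<lambda>m. ?r (2 * m) / ?r (k + m)" "j - k" k "a + 1"]
      by (simp only: shift)
  qed
  finally have P3: "(\<Prod>m=1..a. ?g m) / (\<Prod>m=1..j-k-1. ?g m) = (\<Prod>m\<in>{j..<a + k + 1}. ?r (2 * m) / ?r (k + m))"
    using g by simp
  have "gap_prod (a + k + 1 - j) (j - k) k = gap_det (a + k) j k"
    using gap_det_eq_gap_prod[of k "j - k" "a + k + 1 - j"] assms jk by simp
  also have "\<dots> = col_det (map (\<lambda>i. path_col 0 (int i)) ?K)"
    by (simp add: gap_det_def mult_2 add.assoc)
  finally have P4: "gap_prod (a + k + 1 - j) (j - k) k = col_det (map (\<lambda>i. path_col 0 (int i)) ?K)" .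
  have "col_det (map (\<lambda>i. path_col (int x) (int i)) ?K) * (\<Prod>s<length ?K. ?r (?K ! s))
    = (\<Prod>s<length ?K. ?r (2 * s + 2)) * gap_prod (a + k + 1 - j) (j - k) k"
    unfolding P4 by (rule col_det_path_col_eq) (use jk in auto)
  then have "col_det (map (\<lambda>i. path_col (int x) (int i)) ?K)
    = (\<Prod>s<length ?K. ?r (2 * s + 2)) * gap_prod (a + k + 1 - j) (j - k) k / (\<Prod>s<length ?K. ?r (?K ! s))"
    using r by (simp add: eq_divide_eq)
  also have "\<dots> = (\<Prod>m\<in>{j..<a + k + 1}. ?r (2 * m) / ?r (k + m)) * (\<Prod>m=1..j-1. ?r (2 * m) / ?r m)
      * gap_prod (a + k + 1 - j) (j - k) k"
    unfolding P1 P2 prod_dividef by (simp add: mult_ac)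
  finally show ?thesis unfolding P3 .
qed

lemma prod_powr_swap:
  fixes p q :: "nat \<Rightarrow> nat" and h :: "nat \<Rightarrow> real"
  shows "(\<Prod>n\<in>A. (real (p n) / real (q n)) powr h n) = 1 / (\<Prod>n\<in>A. (real (q n) / real (p n)) powr h n)"
proof -
  have "(real (p n) / real (q n)) powr h n = inverse ((real (q n) / real (p n)) powr h n)" for n
    using inverse_powr[of "real (q n) / real (p n)" "h n"] by simp
  then show ?thesis by (simp add: inverse_eq_divide prod_dividef)
qed

theorem theorem2p1:
  fixes a k x j :: nat
  assumes "max 1 k \<le> j" and "j \<le> a + k + 1"
  shows "real (M (R a k j x)) =
      (\<Prod>n=1..a. (real (x + k + n) / real (k + n)) powr f a n)
    * (\<Prod>n=1..a-1. (real (2*x + 2*k + 2*n + 1) / real (2*k + 2*n + 1)) powr f (a-1) n)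
    * (\<Prod>n=1..j-k-1. (real (k + n) / real (x + k + n)) powr f (j-k-1) n)
    * (\<Prod>n=1..j-k-2. (real (2*k + 2*n + 1) / real (2*x + 2*k + 2*n + 1)) powr f (j-k-2) n)
    * (\<Prod>n=1..j-1. real (x + n) / real (2*x + n))
    * (\<Prod>(n, m)\<in>{(n, m). 1 \<le> n \<and> n \<le> m \<and> m \<le> j-1}.
         real (2*x + n + m - 1) / real (n + m - 1))
    * (\<Prod>n=1..a+k+1-j.
         (\<Prod>m=1..j-k. real (k + n + m - 1) / real (n + m - 1))
       * (\<Prod>m=j-k+1..j-k+n-1. real (2*k + n + m - 1) / real (n + m - 1)))"
proof -
  \<comment> \<open>The second line of the formula is the reciprocal of
    \<open>G (j - k - 1)\<close>.\<close>
  define G where "G = (\<lambda>a. (\<Prod>n=1..a. (real (x + k + n) / real (k + n)) powr f a n) *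
    (\<Prod>n=1..a-1. (real (2*x + 2*k + 2*n + 1) / real (2*k + 2*n + 1)) powr f (a-1) n))"
  have G: "(\<Prod>m=1..a. fact_ratio x (2 * k + 2 * m) / fact_ratio x (2 * k + m)) = G a" for a
    unfolding G_def by (rule prod_powr_f_eq_fact_ratio[symmetric])
  have "real (M (R a k j x)) = col_det (map (\<lambda>i. path_col (int x) (int i)) ([1..<j] @ [j + k..<a + 2 * k + 1]))"
    using M_R_eq_col_det[of j a k x] assms unfolding map_map comp_def by simp
  also have "\<dots> = G a / G (j - k - 1) * (\<Prod>m=1..j-1. fact_ratio x (2 * m) / fact_ratio x m)
      * gap_prod (a + k + 1 - j) (j - k) k"
    unfolding G[symmetric] by (rule col_det_gap_eq[OF assms])
  also have "(\<Prod>m=1..j-1. fact_ratio x (2 * m) / fact_ratio x m)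
    = (\<Prod>n=1..j-1. real (x + n) / real (2*x + n))
      * (\<Prod>(n, m)\<in>{(n, m). 1 \<le> n \<and> n \<le> m \<and> m \<le> j-1}. real (2*x + n + m - 1) / real (n + m - 1))"
    by (rule prod_triangle_eq_fact_ratio[symmetric])
  also have "gap_prod (a + k + 1 - j) (j - k) k = (\<Prod>n=1..a+k+1-j.
         (\<Prod>m=1..j-k. real (k + n + m - 1) / real (n + m - 1))
       * (\<Prod>m=j-k+1..j-k+n-1. real (2*k + n + m - 1) / real (n + m - 1)))"
    (is "_ = (\<Prod>n=1.._. ?F n)")
  proof -
    have "?F (Suc i) = gap_factor (j - k) k i" for i
      using gap_factor_eq_prod[of k i "j - k"] by simp
    then show ?thesis
      using prod.atLeast1_atMost_eq[of ?F "a + k + 1 - j"] by (simp only: gap_prod_def One_nat_def)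
  qed
  also have "G a / G (j - k - 1) = G a
    * (\<Prod>n=1..j-k-1. (real (k + n) / real (x + k + n)) powr f (j-k-1) n)
    * (\<Prod>n=1..j-k-2. (real (2*k + 2*n + 1) / real (2*x + 2*k + 2*n + 1)) powr f (j-k-2) n)"
  proof -
    have "j - k - 1 - 1 = j - k - 2" by simp
    then show ?thesis
      unfolding G_def
        prod_powr_swap[of "\<lambda>n. k + n"] prod_powr_swap[of "\<lambda>n. 2*k + 2*n + 1"] by simp
  qed
  finally show ?thesis unfolding G_def by (simp only: mult.assoc)
qed

end
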